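(* Let $f(x,y)=\sum_{k,l=1}^M\lambda_{k,l}\,g_k(x)h_l(y)$, $M\in\{1,2,\dots\}\cup\{\infty\}$, where $\{g_k\}$ and $\{h_l\}$ are centered and orthonormal: $\mathbf E g_k(\xi)=\mathbf E h_l(\eta)=0$, $\mathbf E g_k(\xi)g_{k'}(\xi)=\delta_{k,k'}$, $\mathbf E h_l(\eta)h_{l'}(\eta)=\delta_{l,l'}$, with $\sigma^2:=\sum_{k,l}\lambda_{k,l}^2\in(0,\infty)$ (series converging in $L_2(\mu\otimes\nu)$), and assume $0<W[f](2)<\infty$. Let $L=L(n_1,n_2)=\{(i,j):1\le i\le n_1,\ 1\le j\le n_2\}$. Then, as $\min(n_1,n_2)\to\infty$, $$S_L[f]\xrightarrow{d} S_\infty:=\sum_{k,l=1}^M\lambda_{k,l}\,\tau_k\,\theta_l,$$ where $\tau_1,\tau_2,\dots,\theta_1,\theta_2,\dots$ are mutually independent standard normal random variables.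
   Context: Let $(X,\mathcal B,\mu)$, $(Y,\mathcal C,\nu)$ be probability spaces and $\xi(1),\xi(2),\dots,\eta(1),\eta(2),\dots$ mutually independent random variables, $\xi(i)$ with law $\mu$, $\eta(j)$ with law $\nu$; $\xi=\xi(1)$, $\eta=\eta(1)$; $|\zeta|_p=(\mathbf E|\zeta|^p)^{1/p}$ and $|f|_p=|f(\xi,\eta)|_p$. For finite non-empty $L\subset\mathbb Z_+^2$, $S_L[f]:=|L|^{-1/2}\sum_{(k_1,k_2)\in L}f(\xi(k_1),\eta(k_2))$. $K_R(p)$ is the smallest constant $K$ such that for all $n$, real $c_i$ and i.i.d. centered $\zeta_i$ with finite $p$-th moment, $|\sum c_i\zeta_i|_p\le K(\sum c_i^2)^{1/2}|\zeta_1|_p$. For finite $M$, $D[M]$ is the set of functions $\sum_{i,j=1}^{M}\lambda_{i,j}g_i(x)h_j(y)$ with centered $g_i\in L_p(\mu)$, $h_j\in L_p(\nu)$; $\|F\|D_p:=\inf\sum|\lambda_{i,j}||g_i(\xi)|_p|h_j(\eta)|_p$ over such (possibly infinite, $L_p$-convergent) representations of $F$; $Q_M[f]_p:=\inf_{\tilde f\in D[M]}|f-\tilde f|_p$ with $Z_M[f]$ a minimizer; and $W[f](p):=\sup_{L}\inf_{M\ge1}[K_R^2(p)\|Z_M[f]\|D_p+|L|^{1/2}Q_M[f]_p]$, sup over finite non-empty $L\subset\mathbb Z_+^2$. *)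

theory Defs
  imports "HOL-Probability.Probability"
begin

definition lpn :: "real \<Rightarrow> 'a measure \<Rightarrow> ('a \<Rightarrow> real) \<Rightarrow> ennreal" where
  "lpn p M F = (let I = (\<integral>\<^sup>+ x. ennreal (\<bar>F x\<bar> powr p) \<partial>M) in
     if I = \<infinity> then \<infinity> else ennreal (enn2real I powr (1 / p)))"

definition centered_Lp :: "real \<Rightarrow> 'a measure \<Rightarrow> ('a \<Rightarrow> real) \<Rightarrow> bool" where
  "centered_Lp p M g \<longleftrightarrow> g \<in> borel_measurable M \<and> integrable M g \<and>
     (\<integral> x. g x \<partial>M) = 0 \<and> lpn p M g < \<infinity>"

text \<open>K_R(p): the smallest constant K with
  |sum c_i zeta_i|_p <= K (sum c_i^2)^(1/2) |zeta_1|_p for all n, reals c_i and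
  i.i.d. centered zeta_i with finite p-th moment.  The i.i.d. family with common law Pz
  is realised canonically on the product space.\<close>
definition KR :: "real \<Rightarrow> ennreal" where
  "KR p = Inf {K :: ennreal. \<forall>(n::nat) (c :: nat \<Rightarrow> real) (Pz :: real measure).
      (prob_space Pz \<and> sets Pz = sets borel \<and> centered_Lp p Pz (\<lambda>x. x)) \<longrightarrow>
      lpn p (Pi\<^sub>M {..<n} (\<lambda>_. Pz)) (\<lambda>\<omega>. \<Sum>i<n. c i * \<omega> i)
        \<le> K * ennreal (sqrt (\<Sum>i<n. (c i)\<^sup>2)) * lpn p Pz (\<lambda>x. x)}"

definition Dset :: "real \<Rightarrow> 'a measure \<Rightarrow> 'b measure \<Rightarrow> nat \<Rightarrow> ('a \<Rightarrow> 'b \<Rightarrow> real) set" where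
  "Dset p mu nu m = {F. \<exists>(lam :: nat \<Rightarrow> nat \<Rightarrow> real) (g :: nat \<Rightarrow> 'a \<Rightarrow> real) (h :: nat \<Rightarrow> 'b \<Rightarrow> real).
      (\<forall>i\<in>{1..m}. centered_Lp p mu (g i)) \<and> (\<forall>j\<in>{1..m}. centered_Lp p nu (h j)) \<and>
      F = (\<lambda>x y. \<Sum>i=1..m. \<Sum>j=1..m. lam i j * g i x * h j y)}"

definition Dnorm :: "real \<Rightarrow> 'a measure \<Rightarrow> 'b measure \<Rightarrow> ('a \<Rightarrow> 'b \<Rightarrow> real) \<Rightarrow> ennreal" where
  "Dnorm p mu nu F = Inf {(\<Sum>\<^sub>\<infinity>(i,j)\<in>UNIV. ennreal \<bar>lam i j\<bar> * lpn p mu (g i) * lpn p nu (h j)) |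
      (lam :: nat \<Rightarrow> nat \<Rightarrow> real) (g :: nat \<Rightarrow> 'a \<Rightarrow> real) (h :: nat \<Rightarrow> 'b \<Rightarrow> real).
      (\<forall>i. centered_Lp p mu (g i)) \<and> (\<forall>j. centered_Lp p nu (h j)) \<and>
      ((\<lambda>N. lpn p (mu \<Otimes>\<^sub>M nu)
          (\<lambda>z. F (fst z) (snd z) - (\<Sum>i<N. \<Sum>j<N. lam i j * g i (fst z) * h j (snd z))))
        \<longlonglongrightarrow> 0)}"

definition Qm :: "real \<Rightarrow> 'a measure \<Rightarrow> 'b measure \<Rightarrow> nat \<Rightarrow> ('a \<Rightarrow> 'b \<Rightarrow> real) \<Rightarrow> ennreal" where
  "Qm p mu nu m f = (INF F\<in>Dset p mu nu m. lpn p (mu \<Otimes>\<^sub>M nu) (\<lambda>z. f (fst z) (snd z) - F (fst z) (snd z)))"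

definition Zm :: "real \<Rightarrow> 'a measure \<Rightarrow> 'b measure \<Rightarrow> nat \<Rightarrow> ('a \<Rightarrow> 'b \<Rightarrow> real) \<Rightarrow> ('a \<Rightarrow> 'b \<Rightarrow> real)" where
  "Zm p mu nu m f = (SOME F. F \<in> Dset p mu nu m \<and>
      lpn p (mu \<Otimes>\<^sub>M nu) (\<lambda>z. f (fst z) (snd z) - F (fst z) (snd z)) = Qm p mu nu m f)"

definition Wf :: "real \<Rightarrow> 'a measure \<Rightarrow> 'b measure \<Rightarrow> ('a \<Rightarrow> 'b \<Rightarrow> real) \<Rightarrow> ennreal" where
  "Wf p mu nu f = (SUP L\<in>{L :: (nat \<times> nat) set. finite L \<and> L \<noteq> {}}.
      INF m\<in>{1::nat..}. (KR p)\<^sup>2 * Dnorm p mu nu (Zm p mu nu m f)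
          + ennreal (sqrt (real (card L))) * Qm p mu nu m f)"

definition SL :: "('a \<Rightarrow> 'b \<Rightarrow> real) \<Rightarrow> (nat \<Rightarrow> 'w \<Rightarrow> 'a) \<Rightarrow> (nat \<Rightarrow> 'w \<Rightarrow> 'b) \<Rightarrow> (nat \<times> nat) set \<Rightarrow> 'w \<Rightarrow> real" where
  "SL f xi eta L w = (1 / sqrt (real (card L))) * (\<Sum>(k1,k2)\<in>L. f (xi k1 w) (eta k2 w))"

definition idx :: "enat \<Rightarrow> nat set" where
  "idx M = {k. 1 \<le> k \<and> enat k \<le> M}"

end

theory Submission
  imports Defs "HOL-Real_Asymp.Real_Asymp"
begin

text \<open>
  Truncating the expansion of \<open>f\<close> at \<open>N\<close> replaces \<open>S\<^sub>L[f]\<close> by a bilinear form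
  \<open>\<Sum> \<lambda>\<^sub>k\<^sub>l G\<^sub>k H\<^sub>l\<close> in the normalised sums \<open>G\<^sub>k\<close> of \<open>g\<^sub>k(\<xi>(i))\<close> and \<open>H\<^sub>l\<close> of
  \<open>h\<^sub>l(\<eta>(j))\<close>. The products \<open>G\<^sub>k H\<^sub>l\<close> are orthonormal, so the error in \<open>L\<^sub>2\<close> is bounded,
  uniformly in \<open>n\<^sub>1, n\<^sub>2\<close>, by the tail of \<open>\<Sum> \<lambda>\<^sub>k\<^sub>l\<^sup>2\<close>.
  For the bilinear form, condition on \<open>H\<close>: the characteristic function becomes that of a linear
  form in \<open>G\<close> with random bounded-in-probability coefficients, and the central limit theorem,
  uniformly over bounded coefficients, replaces \<open>G\<close> by \<open>\<tau>\<close>.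
  Then condition on \<open>\<tau>\<close>, whose law is fixed, and replace \<open>H\<close> by \<open>\<theta>\<close> by dominated
  convergence. Levy's continuity theorem finishes the proof.
\<close>

section \<open>Characteristic functions and orthonormal sums\<close>

text \<open>Independence makes the joint law a product measure, and boundedness lets Fubini apply.
  Conditioning on \<open>Y\<close> becomes an iterated integral over the same space
  \<open>M\<close>.\<close>

lemma (in prob_space) indep_var_integral:
  fixes F :: "_ \<Rightarrow> complex"
  assumes ind: "indep_var S X T Y" and F[measurable]: "F \<in> borel_measurable (S \<Otimes>\<^sub>M T)"
    and bd: "\<And>z. norm (F z) \<le> B"
  shows "(\<integral>w. F (X w, Y w) \<partial>M) = (\<integral>w. (\<integral>w'. F (X w', Y w) \<partial>M) \<partial>M)"
proof -
  have X[measurable]: "X \<in> measurable M S" and Y[measurable]: "Y \<in> measurable M T"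
    and d: "distr M S X \<Otimes>\<^sub>M distr M T Y = distr M (S \<Otimes>\<^sub>M T) (\<lambda>x. (X x, Y x))"
    using ind by (auto simp: indep_var_distribution_eq)
  interpret X: prob_space "distr M S X" by (rule prob_space_distr) fact
  interpret Y: prob_space "distr M T Y" by (rule prob_space_distr) fact
  interpret XY: pair_prob_space "distr M S X" "distr M T Y" ..
  have "(\<integral>w. F (X w, Y w) \<partial>M) = (\<integral>z. F z \<partial>(distr M S X \<Otimes>\<^sub>M distr M T Y))"
    unfolding d by (subst integral_distr) auto
  also have "\<dots> = (\<integral>y. (\<integral>x. F (x, y) \<partial>distr M S X) \<partial>distr M T Y)"
  proof (subst XY.integral_snd)
    show "integrable (distr M S X \<Otimes>\<^sub>M distr M T Y) (case_prod (\<lambda>x y. F (x, y)))"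
      by (rule XY.integrable_const_bound[of _ B]) (auto simp: bd)
  qed simp
  also have "\<dots> = (\<integral>w. (\<integral>x. F (x, Y w) \<partial>distr M S X) \<partial>M)"
    by (rule integral_distr) auto
  also have "\<dots> = (\<integral>w. (\<integral>w'. F (X w', Y w) \<partial>M) \<partial>M)"
    by (intro Bochner_Integration.integral_cong refl integral_distr) (measurable, auto dest: measurable_space[OF Y])
  finally show ?thesis .
qed

text \<open>The factor \<open>iexp y\<close> has modulus 1, which leaves the Taylor bound of order 0
  for \<open>iexp (x - y)\<close>.\<close>

lemma norm_iexp_diff_le: "norm (iexp x - iexp y) \<le> \<bar>x - y\<bar>"
proof -
  have "iexp x - iexp y = iexp y * (iexp (x - y) - 1)"
    by (simp add: algebra_simps flip: exp_add)
  then have "norm (iexp x - iexp y) = norm (iexp (x - y) - 1)"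
    by (simp add: norm_mult)
  also have "\<dots> \<le> \<bar>x - y\<bar>"
    using iexp_approx1[of "x - y" 0] by simp
  finally show ?thesis .
qed

lemma (in prob_space) integrable_iexp_real:
  "Z \<in> borel_measurable M \<Longrightarrow> integrable M (\<lambda>w. iexp (Z w))"
  by (intro integrable_iexp) auto

text \<open>Converts an L2 error into an error of characteristic functions: the exponential is
  Lipschitz, and a first absolute moment is at most the root of the second moment. Both truncation
  errors of the final proof enter through this bound.\<close>

lemma (in prob_space) norm_expectation_iexp_diff_le:
  fixes X Y :: "'a \<Rightarrow> real"
  assumes [measurable]: "X \<in> borel_measurable M" "Y \<in> borel_measurable M"
    and bd: "(\<integral>\<^sup>+w. ennreal ((X w - Y w)\<^sup>2) \<partial>M) \<le> ennreal c" and c: "0 \<le> c"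
  shows "norm ((\<integral>w. iexp (t * X w) \<partial>M) - (\<integral>w. iexp (t * Y w) \<partial>M)) \<le> \<bar>t\<bar> * sqrt c"
proof -
  have i2: "integrable M (\<lambda>w. (\<bar>X w - Y w\<bar>)\<^sup>2)"
    using bd by (intro integrableI_bounded) (auto simp: less_top[symmetric] top_unique)
  have i1: "integrable M (\<lambda>w. \<bar>X w - Y w\<bar>)"
    by (rule square_integrable_imp_integrable[OF _ i2]) simp
  have e2: "expectation (\<lambda>w. (\<bar>X w - Y w\<bar>)\<^sup>2) \<le> c"
    using bd c i2 by (simp add: nn_integral_eq_integral)
  have pt: "norm (iexp (t * X w) - iexp (t * Y w)) \<le> \<bar>t\<bar> * \<bar>X w - Y w\<bar>" for w
    using norm_iexp_diff_le[of "t * X w" "t * Y w"] by (simp add: abs_mult flip: right_diff_distrib)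
  have ii: "integrable M (\<lambda>w. iexp (t * Z w))" if [measurable]: "Z \<in> borel_measurable M" for Z :: "'a \<Rightarrow> real"
    by (rule integrable_iexp_real) measurable
  have "norm ((\<integral>w. iexp (t * X w) \<partial>M) - (\<integral>w. iexp (t * Y w) \<partial>M))
      = norm (\<integral>w. iexp (t * X w) - iexp (t * Y w) \<partial>M)"
    using ii[OF assms(1)] ii[OF assms(2)] by (subst Bochner_Integration.integral_diff) auto
  also have "\<dots> \<le> expectation (\<lambda>w. norm (iexp (t * X w) - iexp (t * Y w)))"
    by (rule integral_norm_bound)
  also have "\<dots> \<le> expectation (\<lambda>w. \<bar>t\<bar> * \<bar>X w - Y w\<bar>)"
    by (intro integral_mono i1 pt integrable_mult_right integrable_norm Bochner_Integration.integrable_diff ii) auto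
  also have "\<dots> = \<bar>t\<bar> * expectation (\<lambda>w. \<bar>X w - Y w\<bar>)"
    by simp
  also have "\<dots> \<le> \<bar>t\<bar> * sqrt c"
  proof (intro mult_left_mono real_le_rsqrt)
    \<comment> \<open>Jensen's inequality for the square, read off from the nonnegativity of the
      variance.\<close>
    show "(expectation (\<lambda>w. \<bar>X w - Y w\<bar>))\<^sup>2 \<le> c"
      using variance_positive[of "\<lambda>w. \<bar>X w - Y w\<bar>"] variance_eq[OF i1 i2] e2 by linarith
  qed simp
  finally show ?thesis .
qed

text \<open>Pythagoras: after expanding the square only the diagonal survives. The measure and the
  index type are arbitrary because it is applied to the functions \<open>u k\<close> under
  \<open>mu\<close>, to normalised sums under \<open>P\<close>, and to products of such sums indexed
  by pairs.\<close>

lemma orthonormal_sum: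
  fixes Z :: "'i \<Rightarrow> 'a \<Rightarrow> real"
  assumes K: "finite K"
    and int: "\<And>k k'. k \<in> K \<Longrightarrow> k' \<in> K \<Longrightarrow> integrable M (\<lambda>w. Z k w * Z k' w)"
    and orth: "\<And>k k'. k \<in> K \<Longrightarrow> k' \<in> K \<Longrightarrow> (\<integral>w. Z k w * Z k' w \<partial>M) = (if k = k' then 1 else 0)"
  shows "integrable M (\<lambda>w. (\<Sum>k\<in>K. a k * Z k w)\<^sup>2)"
    and "(\<integral>w. (\<Sum>k\<in>K. a k * Z k w)\<^sup>2 \<partial>M) = (\<Sum>k\<in>K. (a k)\<^sup>2)"
proof -
  have eq: "(\<Sum>k\<in>K. a k * Z k w)\<^sup>2 = (\<Sum>k\<in>K. \<Sum>k'\<in>K. a k * a k' * (Z k w * Z k' w))" for w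
    by (simp add: power2_eq_square sum_product algebra_simps)
  show "integrable M (\<lambda>w. (\<Sum>k\<in>K. a k * Z k w)\<^sup>2)"
    unfolding eq by (intro Bochner_Integration.integrable_sum integrable_mult_right int)
  have "(\<integral>w. (\<Sum>k\<in>K. a k * Z k w)\<^sup>2 \<partial>M) = (\<Sum>k\<in>K. \<Sum>k'\<in>K. a k * a k' * (if k = k' then 1 else 0))"
    unfolding eq
    by (subst Bochner_Integration.integral_sum, intro Bochner_Integration.integrable_sum integrable_mult_right int, assumption+,
        intro sum.cong refl, subst Bochner_Integration.integral_sum, intro integrable_mult_right int, assumption+,
        simp add: orth)
  also have "\<dots> = (\<Sum>k\<in>K. (a k)\<^sup>2)"
    using K by (simp add: power2_eq_square if_distrib cong: if_cong)
  finally show "(\<integral>w. (\<Sum>k\<in>K. a k * Z k w)\<^sup>2 \<partial>M) = (\<Sum>k\<in>K. (a k)\<^sup>2)" .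
qed

text \<open>The rate \<open>d\<close> is uniform over bounded \<open>b\<close> because the coefficients \<open>b\<close> will be random.\<close>

definition asymp_gaussian :: "'w measure \<Rightarrow> 'i set \<Rightarrow> (nat \<Rightarrow> 'i \<Rightarrow> 'w \<Rightarrow> real) \<Rightarrow> bool" where
  "asymp_gaussian P K U \<longleftrightarrow> (\<forall>R\<ge>0. \<exists>d. d \<longlonglongrightarrow> 0 \<and> (\<forall>n\<ge>1. \<forall>b. (\<Sum>k\<in>K. (b k)\<^sup>2) \<le> R\<^sup>2 \<longrightarrow>
    norm ((\<integral>w. iexp (\<Sum>k\<in>K. b k * U n k w) \<partial>P) - complex_of_real (exp (- (\<Sum>k\<in>K. (b k)\<^sup>2) / 2))) \<le> d n))"

text \<open>For a fixed vector \<open>b\<close> the radius \<open>R\<close> can be its Euclidean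
  norm. The rate says nothing at \<open>n = 0\<close>, which the limit ignores.\<close>

lemma asymp_gaussian_tendsto:
  assumes "asymp_gaussian P K U"
  shows "(\<lambda>n. \<integral>w. iexp (\<Sum>k\<in>K. b k * U n k w) \<partial>P) \<longlonglongrightarrow> complex_of_real (exp (- (\<Sum>k\<in>K. (b k)\<^sup>2) / 2))"
proof -
  define R where "R = sqrt (\<Sum>k\<in>K. (b k)\<^sup>2)"
  have R: "R \<ge> 0" "R\<^sup>2 = (\<Sum>k\<in>K. (b k)\<^sup>2)" by (auto simp: R_def sum_nonneg)
  obtain d where d: "d \<longlonglongrightarrow> 0" "\<forall>n\<ge>1. \<forall>b. (\<Sum>k\<in>K. (b k)\<^sup>2) \<le> R\<^sup>2 \<longrightarrow>
    norm ((\<integral>w. iexp (\<Sum>k\<in>K. b k * U n k w) \<partial>P) - complex_of_real (exp (- (\<Sum>k\<in>K. (b k)\<^sup>2) / 2))) \<le> d n"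
    using assms[unfolded asymp_gaussian_def, rule_format, OF R(1)] by blast
  have "\<forall>\<^sub>F n in sequentially. norm ((\<integral>w. iexp (\<Sum>k\<in>K. b k * U n k w) \<partial>P)
      - complex_of_real (exp (- (\<Sum>k\<in>K. (b k)\<^sup>2) / 2))) \<le> d n"
    unfolding eventually_sequentially using d(2) R(2) by (intro exI[of _ 1]) simp
  from Lim_null_comparison[OF this d(1)] show ?thesis
    by (rule LIM_zero_cancel)
qed

section \<open>Normalised sums of an orthonormal system\<close>

text \<open>One sample with one orthonormal system, kept apart so that it can be instantiated both
  with \<open>xi\<close>, \<open>g\<close> and with \<open>eta\<close>, \<open>h\<close>.\<close>

locale orthonormal_sample = prob_space P for P :: "'w measure" +
  fixes mu :: "'a measure" and X :: "nat \<Rightarrow> 'w \<Rightarrow> 'a"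
    and I :: "'i set" and u :: "'i \<Rightarrow> 'a \<Rightarrow> real"
  assumes X_meas: "\<And>i. i \<ge> 1 \<Longrightarrow> X i \<in> measurable P mu"
    and X_law: "\<And>i. i \<ge> 1 \<Longrightarrow> distr P mu (X i) = mu"
    and X_indep: "indep_vars (\<lambda>_. mu) X {1..}"
    and u_meas: "\<And>k. k \<in> I \<Longrightarrow> u k \<in> borel_measurable mu"
    and u_int: "\<And>k. k \<in> I \<Longrightarrow> integrable mu (u k)"
    and u_centered: "\<And>k. k \<in> I \<Longrightarrow> (\<integral>x. u k x \<partial>mu) = 0"
    and u_orth_int: "\<And>k k'. k \<in> I \<Longrightarrow> k' \<in> I \<Longrightarrow> integrable mu (\<lambda>x. u k x * u k' x)"
    and u_orth: "\<And>k k'. k \<in> I \<Longrightarrow> k' \<in> I \<Longrightarrow> (\<integral>x. u k x * u k' x \<partial>mu) = (if k = k' then 1 else 0)"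
begin

text \<open>At \<open>n = 0\<close> the empty sum and the division by zero give 0, so results on
  unit variance require \<open>n \<ge> 1\<close>.\<close>

definition nsum :: "nat \<Rightarrow> 'i \<Rightarrow> 'w \<Rightarrow> real" where
  "nsum n k w = (\<Sum>i=1..n. u k (X i w)) / sqrt n"

lemma uX_meas: "k \<in> I \<Longrightarrow> i \<ge> 1 \<Longrightarrow> (\<lambda>w. u k (X i w)) \<in> borel_measurable P"
  using measurable_compose[OF X_meas u_meas] .

lemma nsum_meas: "k \<in> I \<Longrightarrow> nsum n k \<in> borel_measurable P"
  unfolding nsum_def by (intro borel_measurable_divide borel_measurable_sum uX_meas) auto

lemma integral_X:
  fixes F :: "'a \<Rightarrow> 'c :: {banach, second_countable_topology}"
  shows "i \<ge> 1 \<Longrightarrow> F \<in> borel_measurable mu \<Longrightarrow> (\<integral>w. F (X i w) \<partial>P) = (\<integral>x. F x \<partial>mu)"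
  using integral_distr[OF X_meas, of i F] X_law[of i] by simp

lemma integrable_X:
  fixes F :: "'a \<Rightarrow> 'c :: {banach, second_countable_topology}"
  shows "i \<ge> 1 \<Longrightarrow> F \<in> borel_measurable mu \<Longrightarrow> integrable mu F \<Longrightarrow> integrable P (\<lambda>w. F (X i w))"
  using integrable_distr_eq[OF X_meas, of i F] X_law[of i] by simp

text \<open>Restricting the independent family to the disjoint singletons \<open>{i}\<close> and
  \<open>{j}\<close> gives two independent random elements, of which the two variables are
  measurable functions.\<close>

lemma uX_indep:
  assumes k: "k \<in> I" "k' \<in> I" and i: "i \<ge> 1" "j \<ge> 1" "i \<noteq> j"
  shows "indep_var borel (\<lambda>w. u k (X i w)) borel (\<lambda>w. u k' (X j w))"
proof -
  have "indep_var borel ((\<lambda>x. u k (x i)) \<circ> (\<lambda>w. restrict (\<lambda>i. X i w) {i}))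
      borel ((\<lambda>x. u k' (x j)) \<circ> (\<lambda>w. restrict (\<lambda>i. X i w) {j}))"
  proof (rule indep_var_compose[OF indep_var_restrict[OF X_indep]])
    show "(\<lambda>x. u k (x i)) \<in> borel_measurable (Pi\<^sub>M {i} (\<lambda>_. mu))"
      by (rule measurable_compose[OF _ u_meas[OF k(1)]]) simp
    show "(\<lambda>x. u k' (x j)) \<in> borel_measurable (Pi\<^sub>M {j} (\<lambda>_. mu))"
      by (rule measurable_compose[OF _ u_meas[OF k(2)]]) simp
  qed (use i in auto)
  then show ?thesis by (simp add: comp_def)
qed

text \<open>On the diagonal the common law reduces the claim to orthonormality under
  \<open>mu\<close>; off the diagonal independence factorises the expectation and centering makes it
  0.\<close>

lemma uX_prod:
  assumes k: "k \<in> I" "k' \<in> I" and i: "i \<ge> 1" "j \<ge> 1"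
  shows "integrable P (\<lambda>w. u k (X i w) * u k' (X j w))"
    and "(\<integral>w. u k (X i w) * u k' (X j w) \<partial>P) = (if i = j \<and> k = k' then 1 else 0)"
proof -
  have "integrable P (\<lambda>w. u k (X i w) * u k' (X j w)) \<and>
    (\<integral>w. u k (X i w) * u k' (X j w) \<partial>P) = (if i = j \<and> k = k' then 1 else 0)"
  proof (cases "i = j")
    case True
    then show ?thesis
      using integrable_X[of i "\<lambda>x. u k x * u k' x"] integral_X[of i "\<lambda>x. u k x * u k' x"]
        u_orth_int[OF k] u_orth[OF k] i k u_meas by auto
  next
    case False
    have *: "integrable P (\<lambda>w. u k (X i w))" "integrable P (\<lambda>w. u k' (X j w))"
      using integrable_X u_int u_meas k i by blast+
    have "(\<integral>w. u k (X i w) \<partial>P) = 0"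
      using integral_X[of i "u k"] u_meas u_centered k i by auto
    then show ?thesis
      using indep_var_lebesgue_integral[OF uX_indep[OF k i False] *]
        indep_var_integrable[OF uX_indep[OF k i False] *] False by simp
  qed
  then show "integrable P (\<lambda>w. u k (X i w) * u k' (X j w))"
    and "(\<integral>w. u k (X i w) * u k' (X j w) \<partial>P) = (if i = j \<and> k = k' then 1 else 0)" by auto
qed

text \<open>Of the \<open>n * n\<close> products only the \<open>n\<close> diagonal ones contribute,
  and the factor \<open>1 / n\<close> cancels them. The covariance is thus exactly the identity for
  every \<open>n \<ge> 1\<close>, the source of all bounds uniform in the sample sizes.\<close>

lemma nsum_prod:
  assumes k: "k \<in> I" "k' \<in> I" and n: "n \<ge> 1"
  shows "integrable P (\<lambda>w. nsum n k w * nsum n k' w)"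
    and "(\<integral>w. nsum n k w * nsum n k' w \<partial>P) = (if k = k' then 1 else 0)"
proof -
  have eq: "nsum n k w * nsum n k' w = (\<Sum>i=1..n. \<Sum>j=1..n. u k (X i w) * u k' (X j w)) / n" for w
    by (simp add: nsum_def sum_product)
  have ij: "integrable P (\<lambda>w. u k (X i w) * u k' (X j w))" if "i \<in> {1..n}" "j \<in> {1..n}" for i j
    using uX_prod(1)[OF k] that by auto
  show "integrable P (\<lambda>w. nsum n k w * nsum n k' w)"
    unfolding eq by (intro integrable_divide_zero Bochner_Integration.integrable_sum ij) auto
  have "(\<integral>w. nsum n k w * nsum n k' w \<partial>P)
      = (\<Sum>i=1..n. \<Sum>j=1..n. (\<integral>w. u k (X i w) * u k' (X j w) \<partial>P)) / n"
  proof -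
    have "(\<integral>w. (\<Sum>i=1..n. \<Sum>j=1..n. u k (X i w) * u k' (X j w)) \<partial>P)
        = (\<Sum>i=1..n. (\<integral>w. (\<Sum>j=1..n. u k (X i w) * u k' (X j w)) \<partial>P))"
      by (intro Bochner_Integration.integral_sum Bochner_Integration.integrable_sum ij)
    also have "\<dots> = (\<Sum>i=1..n. \<Sum>j=1..n. (\<integral>w. u k (X i w) * u k' (X j w) \<partial>P))"
      by (intro sum.cong refl Bochner_Integration.integral_sum ij)
    finally show ?thesis unfolding eq by simp
  qed
  also have "\<dots> = (\<Sum>i=1..n. \<Sum>j=1..n. if i = j \<and> k = k' then 1 else 0) / n"
    using uX_prod(2)[OF k] by simp
  also have "\<dots> = (if k = k' then 1 else 0)"
    using n by auto
  finally show "(\<integral>w. nsum n k w * nsum n k' w \<partial>P) = (if k = k' then 1 else 0)" .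
qed

text \<open>The classical proof of the central limit theorem for one linear form, with every error
  term dominated by a quantity that depends on \<open>b\<close> only through
  \<open>R\<close>.\<close>

lemma nsum_asymp_gaussian:
  assumes K: "finite K" "K \<subseteq> I"
  shows "asymp_gaussian P K nsum"
  unfolding asymp_gaussian_def
proof (intro allI impI)
  fix R :: real assume R: "R \<ge> 0"
  \<comment> \<open>By Cauchy-Schwarz \<open>V\<close> is an envelope for all linear forms in the
    \<open>u k\<close> with coefficient vector of norm at most \<open>R\<close>.\<close>
  define V where "V x = R * sqrt (\<Sum>k\<in>K. (u k x)\<^sup>2)" for x
  \<comment> \<open>The integrand in the remainder of the second-order expansion of a characteristic
    function at \<open>1 / sqrt n\<close>, with the envelope in place of the linear form.\<close>
  define J where "J n x = min (6 * (V x)\<^sup>2) (\<bar>1 / sqrt (real n)\<bar> * \<bar>V x\<bar> ^ 3)" for n x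
  \<comment> \<open>The first term collects \<open>n\<close> Taylor remainders; the second is the
    cost of replacing \<open>1 - s / (2 * n)\<close> by \<open>exp (- s / (2 * n))\<close>,
    \<open>n\<close> times, with \<open>s \<le> R\<^sup>2\<close>.\<close>
  define d where "d n = (\<integral>x. J n x \<partial>mu) / 6 + R ^ 4 / (8 * real n)" for n
  have uK: "u k \<in> borel_measurable mu" if "k \<in> K" for k using u_meas K that by auto
  have [measurable]: "V \<in> borel_measurable mu"
    unfolding V_def using uK by measurable
  have [measurable]: "J n \<in> borel_measurable mu" for n unfolding J_def by measurable
  have V2: "(V x)\<^sup>2 = R\<^sup>2 * (\<Sum>k\<in>K. u k x * u k x)" for x
    by (simp add: V_def power_mult_distrib sum_nonneg power2_eq_square)
  have V0: "V x \<ge> 0" for x using R by (simp add: V_def sum_nonneg)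
  have V2i: "integrable mu (\<lambda>x. (V x)\<^sup>2)"
    unfolding V2 using K by (intro integrable_mult_right Bochner_Integration.integrable_sum u_orth_int) auto
  have mu: "prob_space mu"
    using prob_space_distr[OF X_meas[of 1]] X_law[of 1] by simp
  interpret mu: prob_space mu by fact
  have Ji: "integrable mu (J n)" for n
    by (rule Bochner_Integration.integrable_bound[where f="\<lambda>x. 6 * (V x)\<^sup>2"])
      (auto intro!: V2i simp: J_def V0)
  \<comment> \<open>The minimum in \<open>J\<close> is why second moments suffice: one branch is an
    integrable bound, the other tends to 0 pointwise, so dominated convergence applies.\<close>
  have "d \<longlonglongrightarrow> (\<integral>x. 0 \<partial>mu) / 6 + 0"
    unfolding d_def
  proof (intro tendsto_add tendsto_divide tendsto_const)
    show "(\<lambda>n. \<integral>x. J n x \<partial>mu) \<longlonglongrightarrow> (\<integral>x. 0 \<partial>mu)"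
    proof (rule integral_dominated_convergence[where w="\<lambda>x. 6 * (V x)\<^sup>2"])
      show "AE x in mu. (\<lambda>n. J n x) \<longlonglongrightarrow> 0"
      proof (rule AE_I2)
        fix x
        have "(\<lambda>n. min (6 * (V x)\<^sup>2) (\<bar>1 / sqrt (real n)\<bar> * \<bar>V x\<bar> ^ 3)) \<longlonglongrightarrow> min (6 * (V x)\<^sup>2) (\<bar>0\<bar> * \<bar>V x\<bar> ^ 3)"
          by (intro tendsto_intros tendsto_divide_0[OF tendsto_const] filterlim_at_top_imp_at_infinity
              sqrt_at_top[THEN filterlim_compose] filterlim_real_sequentially)
        then show "(\<lambda>n. J n x) \<longlonglongrightarrow> 0" by (simp add: J_def min_absorb2)
      qed
    qed (auto intro!: V2i simp: J_def V0)
    show "(\<lambda>n. R ^ 4 / (8 * real n)) \<longlonglongrightarrow> 0" by real_asymp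
  qed simp
  then have d0: "d \<longlonglongrightarrow> 0" by simp
  moreover have "norm ((\<integral>w. iexp (\<Sum>k\<in>K. b k * nsum n k w) \<partial>P) - complex_of_real (exp (- (\<Sum>k\<in>K. (b k)\<^sup>2) / 2))) \<le> d n"
    if n: "n \<ge> 1" and b: "(\<Sum>k\<in>K. (b k)\<^sup>2) \<le> R\<^sup>2" for n b
  proof -
    \<comment> \<open>For fixed \<open>b\<close> the problem concerns the i.i.d. scalars
      \<open>Y (X i w)\<close>, centered with variance \<open>s\<close>; \<open>c\<close> is the
      characteristic function of one summand at \<open>1 / sqrt n\<close>.\<close>
    define Y where "Y x = (\<Sum>k\<in>K. b k * u k x)" for x
    define s where "s = (\<Sum>k\<in>K. (b k)\<^sup>2)"
    define t where "t = 1 / sqrt (real n)"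
    define c where "c = char (distr mu borel Y) t"
    have s0: "s \<ge> 0" by (simp add: s_def sum_nonneg)
    have t2: "t\<^sup>2 = 1 / n" by (simp add: t_def power_divide)
    have Ym[measurable]: "Y \<in> borel_measurable mu" unfolding Y_def using uK by measurable
    interpret Y: real_distribution "distr mu borel Y" by (rule mu.real_distribution_distr) simp
    have Y2i: "integrable mu (\<lambda>x. (Y x)\<^sup>2)" and Y2: "(\<integral>x. (Y x)\<^sup>2 \<partial>mu) = s"
      unfolding Y_def s_def using K
      by (auto intro!: orthonormal_sum u_orth_int u_orth)
    have Yi: "integrable mu Y" by (rule mu.square_integrable_imp_integrable[OF Ym Y2i])
    have Y1: "(\<integral>x. Y x \<partial>mu) = 0"
      unfolding Y_def using K by (subst Bochner_Integration.integral_sum) (auto intro!: u_int sum.neutral u_centered)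
    have YV: "\<bar>Y x\<bar> \<le> V x" for x
    proof (rule power2_le_imp_le)
      have "(Y x)\<^sup>2 \<le> (\<Sum>k\<in>K. (b k)\<^sup>2) * (\<Sum>k\<in>K. (u k x)\<^sup>2)"
        unfolding Y_def by (rule Cauchy_Schwarz_ineq_sum)
      also have "\<dots> \<le> R\<^sup>2 * (\<Sum>k\<in>K. (u k x)\<^sup>2)"
        by (intro mult_right_mono b sum_nonneg) simp
      finally show "\<bar>Y x\<bar>\<^sup>2 \<le> (V x)\<^sup>2" unfolding V2 power2_abs by (simp add: power2_eq_square)
    qed fact
    have "norm (c - (1 - t\<^sup>2 * s / 2)) \<le> t\<^sup>2 / 6 * (\<integral>x. min (6 * (Y x)\<^sup>2) (\<bar>t\<bar> * \<bar>Y x\<bar> ^ 3) \<partial>mu)"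
      unfolding c_def using Y1 Y2 by (intro mu.char_approx3' Ym Yi Y2i refl) auto
    also have "\<dots> \<le> t\<^sup>2 / 6 * (\<integral>x. J n x \<partial>mu)"
    proof (intro mult_left_mono integral_mono Ji)
      have *: "(Y x)\<^sup>2 \<le> (V x)\<^sup>2" "\<bar>Y x\<bar> ^ 3 \<le> \<bar>V x\<bar> ^ 3" for x
        using YV[of x] by (auto intro!: power_mono simp: abs_le_square_iff[symmetric])
      show mono: "min (6 * (Y x)\<^sup>2) (\<bar>t\<bar> * \<bar>Y x\<bar> ^ 3) \<le> J n x" for x
        unfolding J_def t_def by (intro min.mono mult_left_mono *) auto
      show "integrable mu (\<lambda>x. min (6 * (Y x)\<^sup>2) (\<bar>t\<bar> * \<bar>Y x\<bar> ^ 3))"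
        by (rule Bochner_Integration.integrable_bound[OF Ji[of n]])
          (auto simp: intro!: order_trans[OF mono])
    qed simp
    finally have c1: "norm (c - (1 - t\<^sup>2 * s / 2)) \<le> t\<^sup>2 / 6 * (\<integral>x. J n x \<partial>mu)" .
    define y where "y = s / (2 * n)"
    have y0: "y \<ge> 0" using s0 by (simp add: y_def)
    \<comment> \<open>The difference of the two sides vanishes at 0 and has the derivative
      \<open>-1 + z + exp (-z)\<close>, which is nonnegative.\<close>
    have "exp (-y) \<le> 1 - y + y\<^sup>2 / 2"
    proof -
      have "(\<lambda>y::real. 1 - y + y\<^sup>2 / 2 - exp (-y)) 0 \<le> (\<lambda>y::real. 1 - y + y\<^sup>2 / 2 - exp (-y)) y"
      proof (rule DERIV_nonneg_imp_nondecreasing[OF y0])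
        fix z :: real assume "0 \<le> z"
        have "((\<lambda>y::real. 1 - y + y\<^sup>2 / 2 - exp (-y)) has_real_derivative (-1 + z + exp (-z))) (at z)"
          by (auto intro!: derivative_eq_intros)
        moreover have "-1 + z + exp (-z) \<ge> 0" using exp_ge_add_one_self[of "-z"] by simp
        ultimately show "\<exists>y. ((\<lambda>y::real. 1 - y + y\<^sup>2 / 2 - exp (-y)) has_real_derivative y) (at z) \<and> 0 \<le> y" by blast
      qed
      then show ?thesis by simp
    qed
    then have y2: "\<bar>(1 - y) - exp (-y)\<bar> \<le> y\<^sup>2 / 2"
      using exp_ge_add_one_self[of "-y"] by simp
    have "norm (c - exp (-y)) \<le> norm (c - (1 - t\<^sup>2 * s / 2)) + norm (complex_of_real ((1 - y) - exp (-y)))"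
      using norm_triangle_ineq[of "c - (1 - t\<^sup>2 * s / 2)" "complex_of_real ((1 - y) - exp (-y))"]
      by (simp add: t2 y_def)
    also have "\<dots> \<le> t\<^sup>2 / 6 * (\<integral>x. J n x \<partial>mu) + y\<^sup>2 / 2"
      using c1 y2 by (intro add_mono) (auto simp only: norm_of_real)
    finally have c2: "norm (c - exp (-y)) \<le> t\<^sup>2 / 6 * (\<integral>x. J n x \<partial>mu) + y\<^sup>2 / 2" .
    have "(\<integral>w. iexp (\<Sum>k\<in>K. b k * nsum n k w) \<partial>P) = char (distr P borel (\<lambda>w. \<Sum>i\<in>{1..n}. Y (X i w))) t"
    proof -
      have "(\<lambda>w. Y (X i w)) \<in> borel_measurable P" if "i \<in> {1..n}" for i
        using X_meas[of i] that by simp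
      then have m: "(\<lambda>w. \<Sum>i\<in>{1..n}. Y (X i w)) \<in> borel_measurable P" by measurable
      have "(\<Sum>k\<in>K. b k * nsum n k w) = t * (\<Sum>i\<in>{1..n}. Y (X i w))" for w
        unfolding nsum_def Y_def t_def
        by (simp add: sum_distrib_left sum_divide_distrib, subst sum.swap, simp)
      then show ?thesis unfolding char_def using m by (subst integral_distr) auto
    qed
    also have "\<dots> = (\<Prod>i\<in>{1..n}. char (distr P borel (\<lambda>w. Y (X i w))) t)"
      by (intro char_distr_sum indep_vars_compose2[OF indep_vars_subset[OF X_indep]] Ym) auto
    also have "\<dots> = (\<Prod>i\<in>{1..n}. c)"
    proof (intro prod.cong refl)
      fix i assume "i \<in> {1..n}"
      then have i: "i \<ge> 1" by simp
      have "distr P borel (\<lambda>w. Y (X i w)) = distr (distr P mu (X i)) borel Y"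
        using X_meas[OF i] by (subst distr_distr) (auto simp: comp_def)
      then show "char (distr P borel (\<lambda>w. Y (X i w))) t = c" by (simp add: c_def X_law[OF i])
    qed
    finally have "(\<integral>w. iexp (\<Sum>k\<in>K. b k * nsum n k w) \<partial>P) = c ^ n" by simp
    moreover have "complex_of_real (exp (- s / 2)) = complex_of_real (exp (-y)) ^ n"
      using n by (simp add: y_def exp_of_nat_mult[symmetric] flip: of_real_power)
    ultimately have "norm ((\<integral>w. iexp (\<Sum>k\<in>K. b k * nsum n k w) \<partial>P) - complex_of_real (exp (- s / 2)))
        = norm (c ^ n - complex_of_real (exp (-y)) ^ n)" by simp
    \<comment> \<open>Powers of numbers in the unit disc differ by at most \<open>n\<close> times
      the difference of the bases. This factor \<open>n\<close> is absorbed by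
      \<open>t\<^sup>2 = 1 / n\<close> and by \<open>y\<^sup>2\<close>, of order
      \<open>1 / n\<^sup>2\<close>.\<close>
    also have "\<dots> \<le> n * norm (c - complex_of_real (exp (-y)))"
      by (rule norm_power_diff) (auto simp: c_def Y.cmod_char_le_1 y0)
    also have "\<dots> \<le> n * (t\<^sup>2 / 6 * (\<integral>x. J n x \<partial>mu) + y\<^sup>2 / 2)"
      by (intro mult_left_mono c2) simp
    also have "\<dots> = (\<integral>x. J n x \<partial>mu) / 6 + s\<^sup>2 / (8 * n)"
      unfolding t2 y_def using n by (simp add: field_simps power2_eq_square)
    also have "\<dots> \<le> d n"
    proof -
      have "s\<^sup>2 \<le> (R\<^sup>2)\<^sup>2" using b s0 by (intro power_mono) (auto simp: s_def)
      then show ?thesis by (auto simp: d_def intro!: divide_right_mono)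
    qed
    finally show ?thesis by (simp add: s_def)
  qed
  ultimately show "\<exists>d. d \<longlonglongrightarrow> 0 \<and> (\<forall>n\<ge>1. \<forall>b. (\<Sum>k\<in>K. (b k)\<^sup>2) \<le> R\<^sup>2 \<longrightarrow>
    norm ((\<integral>w. iexp (\<Sum>k\<in>K. b k * nsum n k w) \<partial>P) - complex_of_real (exp (- (\<Sum>k\<in>K. (b k)\<^sup>2) / 2))) \<le> d n)"
    by blast
qed

end

section \<open>Bilinear forms in two independent vectors\<close>

text \<open>With \<open>V\<close> frozen, the bilinear form is linear in \<open>U\<close> with
  coefficients \<open>\<Sum>l\<in>K. a k l * V l w\<close>. The vectors are restricted to
  \<open>K\<close> because points of the product space are extensional functions.\<close>

lemma (in prob_space) bilinear_char_condition:
  fixes U V :: "'i \<Rightarrow> 'a \<Rightarrow> real"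
  assumes K: "finite K"
    and ind: "indep_var (Pi\<^sub>M K (\<lambda>_. borel)) (\<lambda>w. restrict (\<lambda>k. U k w) K)
      (Pi\<^sub>M K (\<lambda>_. borel)) (\<lambda>w. restrict (\<lambda>k. V k w) K)"
  shows "(\<integral>w. iexp (\<Sum>k\<in>K. \<Sum>l\<in>K. a k l * U k w * V l w) \<partial>M)
    = (\<integral>w. (\<integral>w'. iexp (\<Sum>k\<in>K. (\<Sum>l\<in>K. a k l * V l w) * U k w') \<partial>M) \<partial>M)"
proof -
  define F where "F z = iexp (\<Sum>k\<in>K. \<Sum>l\<in>K. a k l * fst z k * snd z l)" for z
  have c: "(\<lambda>x. x k) \<in> borel_measurable (Pi\<^sub>M K (\<lambda>_. borel :: real measure))" if "k \<in> K" for k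
    using that by measurable
  have "(\<lambda>z. \<Sum>k\<in>K. \<Sum>l\<in>K. a k l * fst z k * snd z l)
      \<in> borel_measurable (Pi\<^sub>M K (\<lambda>_. borel) \<Otimes>\<^sub>M Pi\<^sub>M K (\<lambda>_. borel))"
    by (intro borel_measurable_sum borel_measurable_times borel_measurable_const
        measurable_compose[OF measurable_fst c] measurable_compose[OF measurable_snd c])
  then have F: "F \<in> borel_measurable (Pi\<^sub>M K (\<lambda>_. borel) \<Otimes>\<^sub>M Pi\<^sub>M K (\<lambda>_. borel))"
    unfolding F_def by measurable
  have "(\<integral>w. F (restrict (\<lambda>k. U k w) K, restrict (\<lambda>k. V k w) K) \<partial>M)
      = (\<integral>w. (\<integral>w'. F (restrict (\<lambda>k. U k w') K, restrict (\<lambda>k. V k w) K) \<partial>M) \<partial>M)"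
    by (rule indep_var_integral[OF ind F, of 1]) (simp add: F_def)
  moreover have "F (restrict (\<lambda>k. U k w') K, restrict (\<lambda>k. V k w) K)
      = iexp (\<Sum>k\<in>K. (\<Sum>l\<in>K. a k l * V l w) * U k w')" for w w'
    by (simp add: F_def sum_distrib_left sum_distrib_right mult_ac cong: sum.cong)
  moreover have "F (restrict (\<lambda>k. U k w) K, restrict (\<lambda>k. V k w) K)
      = iexp (\<Sum>k\<in>K. \<Sum>l\<in>K. a k l * U k w * V l w)" for w
    by (simp add: F_def cong: sum.cong)
  ultimately show ?thesis by simp
qed

text \<open>Fubini on \<open>P \<Otimes>\<^sub>M Q\<close> together with an exchange of the finite
  sums. It changes a linear form in \<open>T\<close> with coefficients from \<open>V\<close> into a
  linear form in \<open>V\<close> with coefficients from \<open>T\<close>.\<close>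

lemma bilinear_char_swap:
  fixes V :: "'i \<Rightarrow> 'w \<Rightarrow> real" and T :: "'i \<Rightarrow> 'q \<Rightarrow> real"
  assumes P: "prob_space P" and Q: "prob_space Q" and K: "finite K"
    and V: "\<And>k. k \<in> K \<Longrightarrow> V k \<in> borel_measurable P"
    and T: "\<And>k. k \<in> K \<Longrightarrow> T k \<in> borel_measurable Q"
  shows "(\<integral>w. (\<integral>q. iexp (\<Sum>k\<in>K. (\<Sum>l\<in>K. a k l * V l w) * T k q) \<partial>Q) \<partial>P)
    = (\<integral>q. (\<integral>w. iexp (\<Sum>l\<in>K. (\<Sum>k\<in>K. a k l * T k q) * V l w) \<partial>P) \<partial>Q)"
proof -
  interpret P: prob_space P by fact
  interpret Q: prob_space Q by fact
  interpret PQ: pair_prob_space P Q ..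
  have "(\<lambda>z. \<Sum>k\<in>K. (\<Sum>l\<in>K. a k l * V l (fst z)) * T k (snd z)) \<in> borel_measurable (P \<Otimes>\<^sub>M Q)"
    by (intro borel_measurable_sum borel_measurable_times borel_measurable_const
        measurable_compose[OF measurable_fst V] measurable_compose[OF measurable_snd T])
  then have "integrable (P \<Otimes>\<^sub>M Q) (\<lambda>z. iexp (\<Sum>k\<in>K. (\<Sum>l\<in>K. a k l * V l (fst z)) * T k (snd z)))"
    by (rule PQ.integrable_iexp_real)
  then have "(\<integral>w. (\<integral>q. iexp (\<Sum>k\<in>K. (\<Sum>l\<in>K. a k l * V l w) * T k q) \<partial>Q) \<partial>P)
    = (\<integral>q. (\<integral>w. iexp (\<Sum>k\<in>K. (\<Sum>l\<in>K. a k l * V l w) * T k q) \<partial>P) \<partial>Q)"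
    by (intro PQ.Fubini_integral[symmetric]) (simp add: case_prod_beta')
  moreover have "(\<Sum>k\<in>K. (\<Sum>l\<in>K. a k l * V l w) * T k q) = (\<Sum>l\<in>K. (\<Sum>k\<in>K. a k l * T k q) * V l w)" for w q
    by (simp add: sum_distrib_right, subst sum.swap, simp add: mult_ac)
  ultimately show ?thesis by (simp only:)
qed

lemma (in prob_space) std_normal_char:
  fixes T :: "'i \<Rightarrow> 'a \<Rightarrow> real"
  assumes K: "K \<subseteq> I"
    and norm: "\<And>k. k \<in> I \<Longrightarrow> distributed M lborel (T k) (\<lambda>x. ennreal (std_normal_density x))"
    and ind: "indep_vars (\<lambda>_. borel) T I"
  shows "(\<integral>w. iexp (\<Sum>k\<in>K. b k * T k w) \<partial>M) = complex_of_real (exp (- (\<Sum>k\<in>K. (b k)\<^sup>2) / 2))"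
proof -
  have T: "T k \<in> borel_measurable M" if "k \<in> K" for k
    using distributed_measurable[OF norm[of k]] K that by auto
  \<comment> \<open>The coefficient is absorbed into the variable, so that all factors are evaluated
    at the argument 1.\<close>
  have ch: "char (distr M borel (\<lambda>w. b k * T k w)) 1 = complex_of_real (exp (- (b k)\<^sup>2 / 2))"
    if k: "k \<in> K" for k
  proof -
    have "distr M borel (T k) = distr M lborel (T k)"
      by (rule distr_cong) auto
    also have "\<dots> = std_normal_distribution"
      using distributed_distr_eq_density[OF norm[of k]] K k by auto
    finally have "char (distr M borel (T k)) (b k) = complex_of_real (exp (- (b k)\<^sup>2 / 2))"
      by (simp add: char_std_normal_distribution)
    then show ?thesis
      using T[OF k] by (simp add: char_def integral_distr)
  qed
  have "(\<integral>w. iexp (\<Sum>k\<in>K. b k * T k w) \<partial>M) = char (distr M borel (\<lambda>w. \<Sum>k\<in>K. b k * T k w)) 1"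
    unfolding char_def using T by (subst integral_distr) auto
  also have "\<dots> = (\<Prod>k\<in>K. char (distr M borel (\<lambda>w. b k * T k w)) 1)"
    by (intro char_distr_sum indep_vars_compose2[OF indep_vars_subset[OF ind K]]) auto
  also have "\<dots> = (\<Prod>k\<in>K. complex_of_real (exp (- (b k)\<^sup>2 / 2)))"
    by (intro prod.cong refl ch)
  \<comment> \<open>For infinite \<open>K\<close> the sum is 0 and the product is 1 by convention,
    and both sides equal 1.\<close>
  also have "\<dots> = complex_of_real (exp (- (\<Sum>k\<in>K. (b k)\<^sup>2) / 2))"
    by (cases "finite K") (simp_all add: exp_sum sum_divide_distrib flip: of_real_prod sum_negf)
  finally show ?thesis .
qed

text \<open>Given \<open>V\<close>, the vector \<open>U\<close> is replaced by \<open>T\<close> with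
  an error uniform in \<open>m\<close>; given \<open>T\<close>, the vector \<open>V\<close> is then
  replaced by \<open>S\<close>. The uniformity gives a joint limit in \<open>(n, m)\<close> and not
  merely an iterated one; it rests on the second moment bound \<open>C\<close> for the random
  coefficients.\<close>

lemma bilinear_limit:
  fixes U V :: "nat \<Rightarrow> 'i \<Rightarrow> 'w \<Rightarrow> real" and T S :: "'i \<Rightarrow> 'q \<Rightarrow> real"
  assumes P: "prob_space P" and Q: "prob_space Q" and K: "finite K"
    and U: "\<And>n k. k \<in> K \<Longrightarrow> U n k \<in> borel_measurable P"
    and V: "\<And>n k. k \<in> K \<Longrightarrow> V n k \<in> borel_measurable P"
    and UV: "\<And>n m. prob_space.indep_var P (Pi\<^sub>M K (\<lambda>_. borel)) (\<lambda>w. restrict (\<lambda>k. U n k w) K)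
      (Pi\<^sub>M K (\<lambda>_. borel)) (\<lambda>w. restrict (\<lambda>k. V m k w) K)"
    and Ug: "asymp_gaussian P K U" and Vg: "asymp_gaussian P K V"
    and Vi: "\<And>m. m \<ge> 1 \<Longrightarrow> integrable P (\<lambda>w. \<Sum>k\<in>K. (\<Sum>l\<in>K. a k l * V m l w)\<^sup>2)"
    and Vb: "\<And>m. m \<ge> 1 \<Longrightarrow> (\<integral>w. (\<Sum>k\<in>K. (\<Sum>l\<in>K. a k l * V m l w)\<^sup>2) \<partial>P) \<le> C"
    and T: "\<And>k. k \<in> K \<Longrightarrow> T k \<in> borel_measurable Q"
    and S: "\<And>k. k \<in> K \<Longrightarrow> S k \<in> borel_measurable Q"
    and TS: "prob_space.indep_var Q (Pi\<^sub>M K (\<lambda>_. borel)) (\<lambda>w. restrict (\<lambda>k. T k w) K)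
      (Pi\<^sub>M K (\<lambda>_. borel)) (\<lambda>w. restrict (\<lambda>k. S k w) K)"
    and Tg: "\<And>b. (\<integral>w. iexp (\<Sum>k\<in>K. b k * T k w) \<partial>Q) = complex_of_real (exp (- (\<Sum>k\<in>K. (b k)\<^sup>2) / 2))"
    and Sg: "\<And>b. (\<integral>w. iexp (\<Sum>k\<in>K. b k * S k w) \<partial>Q) = complex_of_real (exp (- (\<Sum>k\<in>K. (b k)\<^sup>2) / 2))"
  shows "((\<lambda>(n, m). \<integral>w. iexp (\<Sum>k\<in>K. \<Sum>l\<in>K. a k l * U n k w * V m l w) \<partial>P)
    \<longlongrightarrow> (\<integral>q. iexp (\<Sum>k\<in>K. \<Sum>l\<in>K. a k l * T k q * S l q) \<partial>Q)) (sequentially \<times>\<^sub>F sequentially)"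
proof -
  interpret P: prob_space P by fact
  interpret Q: prob_space Q by fact
  define \<Phi> where "\<Phi> n m = (\<integral>w. iexp (\<Sum>k\<in>K. \<Sum>l\<in>K. a k l * U n k w * V m l w) \<partial>P)" for n m
  define b where "b m w k = (\<Sum>l\<in>K. a k l * V m l w)" for m w k
  define \<psi> where "\<psi> m w = complex_of_real (exp (- (\<Sum>k\<in>K. (b m w k)\<^sup>2) / 2))" for m w
  define \<phi> where "\<phi> n m w = (\<integral>w'. iexp (\<Sum>k\<in>K. b m w k * U n k w') \<partial>P)" for n m w
  define \<Lambda> where "\<Lambda> = (\<integral>q. iexp (\<Sum>k\<in>K. \<Sum>l\<in>K. a k l * T k q * S l q) \<partial>Q)"
  have \<Phi>: "\<Phi> n m = (\<integral>w. \<phi> n m w \<partial>P)" for n m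
    unfolding \<Phi>_def \<phi>_def b_def by (rule P.bilinear_char_condition[OF K UV])
  have bm: "(\<lambda>w. b m w k) \<in> borel_measurable P" for m k
    unfolding b_def using V by measurable
  have \<psi>m: "\<psi> m \<in> borel_measurable P" for m
    unfolding \<psi>_def using bm by measurable
  have \<phi>m: "\<phi> n m \<in> borel_measurable P" for n m
  proof -
    have "(\<lambda>z. \<Sum>k\<in>K. b m (fst z) k * U n k (snd z)) \<in> borel_measurable (P \<Otimes>\<^sub>M P)"
      by (intro borel_measurable_sum borel_measurable_times
        measurable_compose[OF measurable_fst bm] measurable_compose[OF measurable_snd U])
    then have "(\<lambda>(w, w'). iexp (\<Sum>k\<in>K. b m w k * U n k w')) \<in> borel_measurable (P \<Otimes>\<^sub>M P)"
      unfolding case_prod_beta' by measurable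
    then show ?thesis
      unfolding \<phi>_def by (rule P.borel_measurable_lebesgue_integral)
  qed
  have iexp1: "norm (\<integral>w. iexp (Z w) \<partial>P) \<le> 1" for Z :: "'w \<Rightarrow> real"
    using integral_norm_bound[of P "\<lambda>w. iexp (Z w)"] by (simp add: P.prob_space)
  have \<phi>1: "norm (\<phi> n m w) \<le> 1" for n m w
    unfolding \<phi>_def by (rule iexp1)
  have \<psi>1: "norm (\<psi> m w) \<le> 1" for m w
    by (simp add: \<psi>_def sum_nonneg)
  have \<phi>i: "integrable P (\<phi> n m)" for n m
    by (rule P.integrable_const_bound[of _ 1]) (auto simp: \<phi>1 \<phi>m)
  have \<psi>i: "integrable P (\<psi> m)" for m
    by (rule P.integrable_const_bound[of _ 1]) (auto simp: \<psi>1 \<psi>m)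
  have unif: "\<exists>N. \<forall>n\<ge>N. \<forall>m\<ge>1. norm (\<Phi> n m - (\<integral>w. \<psi> m w \<partial>P)) < e" if e: "e > 0" for e
  proof -
    \<comment> \<open>Chosen so that the Markov term \<open>2 * \<bar>C\<bar> / R\<^sup>2\<close> is
      at most \<open>e / 2\<close>; the added 1 keeps \<open>R\<close> positive also when
      \<open>C = 0\<close>.\<close>
    define R where "R = sqrt (4 * \<bar>C\<bar> / e) + 1"
    have R: "R > 0" using e by (simp add: R_def add_nonneg_pos)
    have "4 * \<bar>C\<bar> / e = (sqrt (4 * \<bar>C\<bar> / e))\<^sup>2" using e by simp
    also have "\<dots> \<le> R\<^sup>2" using e by (intro power_mono) (auto simp: R_def)
    finally have R2: "2 / R\<^sup>2 * \<bar>C\<bar> \<le> e / 2" using e R by (simp add: field_simps)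
    obtain d where d: "d \<longlonglongrightarrow> 0" "\<forall>n\<ge>1. \<forall>b. (\<Sum>k\<in>K. (b k)\<^sup>2) \<le> R\<^sup>2 \<longrightarrow>
        norm ((\<integral>w. iexp (\<Sum>k\<in>K. b k * U n k w) \<partial>P) - complex_of_real (exp (- (\<Sum>k\<in>K. (b k)\<^sup>2) / 2))) \<le> d n"
      using Ug[unfolded asymp_gaussian_def, rule_format, of R] R by auto
    obtain N where N: "\<And>n. n \<ge> N \<Longrightarrow> \<bar>d n\<bar> < e / 2"
      using LIMSEQ_D[OF d(1), of "e / 2"] e by auto
    have "norm (\<Phi> n m - (\<integral>w. \<psi> m w \<partial>P)) < e" if n: "n \<ge> max N 1" and m: "m \<ge> 1" for n m
    proof -
      \<comment> \<open>Inside the ball of radius \<open>R\<close> the rate \<open>d n\<close>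
        applies. Outside it the difference is at most 2, and the factor
        \<open>(\<Sum>k\<in>K. (b m w k)\<^sup>2) / R\<^sup>2\<close> exceeds 1.\<close>
      have pt: "norm (\<phi> n m w - \<psi> m w) \<le> \<bar>d n\<bar> + 2 / R\<^sup>2 * (\<Sum>k\<in>K. (b m w k)\<^sup>2)" for w
      proof (cases "(\<Sum>k\<in>K. (b m w k)\<^sup>2) \<le> R\<^sup>2")
        case True
        then have "norm (\<phi> n m w - \<psi> m w) \<le> d n"
          unfolding \<phi>_def \<psi>_def using n True by (intro d(2)[rule_format]) auto
        moreover have "0 \<le> 2 / R\<^sup>2 * (\<Sum>k\<in>K. (b m w k)\<^sup>2)" by (intro mult_nonneg_nonneg sum_nonneg) auto
        ultimately show ?thesis by linarith
      next
        case False
        have "norm (\<phi> n m w - \<psi> m w) \<le> 2"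
          using norm_triangle_ineq4[of "\<phi> n m w" "\<psi> m w"] \<phi>1[of n m w] \<psi>1[of m w] by linarith
        moreover have "2 \<le> 2 / R\<^sup>2 * (\<Sum>k\<in>K. (b m w k)\<^sup>2)"
          using False R by (simp add: field_simps)
        ultimately show ?thesis by linarith
      qed
      have bi: "integrable P (\<lambda>w. \<Sum>k\<in>K. (b m w k)\<^sup>2)" and bC: "(\<integral>w. (\<Sum>k\<in>K. (b m w k)\<^sup>2) \<partial>P) \<le> C"
        unfolding b_def using Vi[OF m] Vb[OF m] by auto
      have "norm (\<Phi> n m - (\<integral>w. \<psi> m w \<partial>P)) = norm (\<integral>w. \<phi> n m w - \<psi> m w \<partial>P)"
        unfolding \<Phi> by (simp add: \<phi>i \<psi>i)
      also have "\<dots> \<le> (\<integral>w. norm (\<phi> n m w - \<psi> m w) \<partial>P)"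
        by (rule integral_norm_bound)
      also have "\<dots> \<le> (\<integral>w. \<bar>d n\<bar> + 2 / R\<^sup>2 * (\<Sum>k\<in>K. (b m w k)\<^sup>2) \<partial>P)"
        by (intro integral_mono pt integrable_norm Bochner_Integration.integrable_diff \<phi>i \<psi>i
            Bochner_Integration.integrable_add integrable_mult_right bi) simp
      also have "\<dots> = \<bar>d n\<bar> + 2 / R\<^sup>2 * (\<integral>w. (\<Sum>k\<in>K. (b m w k)\<^sup>2) \<partial>P)"
        by (subst Bochner_Integration.integral_add) (auto simp: bi P.prob_space)
      also have "\<dots> \<le> \<bar>d n\<bar> + 2 / R\<^sup>2 * \<bar>C\<bar>"
        using bC by (intro add_mono mult_left_mono) auto
      also have "\<dots> < e / 2 + e / 2" using N[of n] n R2 by (intro add_less_le_mono) auto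
      finally show ?thesis by simp
    qed
    then show ?thesis by blast
  qed
  have lim: "(\<lambda>m. \<integral>w. \<psi> m w \<partial>P) \<longlonglongrightarrow> \<Lambda>"
  proof -
    define c where "c q l = (\<Sum>k\<in>K. a k l * T k q)" for q l
    \<comment> \<open>Read backwards, \<open>Tg\<close> writes the Gaussian factor as an average
      over \<open>T\<close>, which the swap turns into a linear form in \<open>V\<close>.\<close>
    have "(\<integral>w. \<psi> m w \<partial>P) = (\<integral>q. (\<integral>w. iexp (\<Sum>l\<in>K. c q l * V m l w) \<partial>P) \<partial>Q)" for m
      unfolding \<psi>_def Tg[symmetric] b_def c_def by (rule bilinear_char_swap[OF P Q K V T])
    moreover have "\<Lambda> = (\<integral>q. (\<integral>w. iexp (\<Sum>l\<in>K. c q l * S l w) \<partial>Q) \<partial>Q)"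
      unfolding \<Lambda>_def Q.bilinear_char_condition[OF K TS] c_def by (rule bilinear_char_swap[OF Q Q K S T])
    \<comment> \<open>For each \<open>q\<close> the coefficients \<open>c q\<close> are fixed, so
      the central limit theorem for \<open>V\<close> gives pointwise convergence; the law of these
      coefficients does not vary with \<open>m\<close>, and 1 dominates.\<close>
    moreover have "(\<lambda>m. \<integral>q. (\<integral>w. iexp (\<Sum>l\<in>K. c q l * V m l w) \<partial>P) \<partial>Q)
        \<longlonglongrightarrow> (\<integral>q. (\<integral>w. iexp (\<Sum>l\<in>K. c q l * S l w) \<partial>Q) \<partial>Q)"
    proof (rule integral_dominated_convergence[where w="\<lambda>_. 1"])
      have cm: "(\<lambda>q. c q l) \<in> borel_measurable Q" for l unfolding c_def using T by measurable
      then show "(\<lambda>q. \<integral>w. iexp (\<Sum>l\<in>K. c q l * S l w) \<partial>Q) \<in> borel_measurable Q"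
        unfolding Sg by measurable
      show "(\<lambda>q. \<integral>w. iexp (\<Sum>l\<in>K. c q l * V m l w) \<partial>P) \<in> borel_measurable Q" for m
      proof (rule P.borel_measurable_lebesgue_integral)
        have "(\<lambda>z. \<Sum>l\<in>K. c (fst z) l * V m l (snd z)) \<in> borel_measurable (Q \<Otimes>\<^sub>M P)"
          by (intro borel_measurable_sum borel_measurable_times
            measurable_compose[OF measurable_fst cm] measurable_compose[OF measurable_snd V])
        then show "(\<lambda>(q, w). iexp (\<Sum>l\<in>K. c q l * V m l w)) \<in> borel_measurable (Q \<Otimes>\<^sub>M P)"
          unfolding case_prod_beta' by measurable
      qed
      show "AE q in Q. norm (\<integral>w. iexp (\<Sum>l\<in>K. c q l * V m l w) \<partial>P) \<le> 1" for m
        by (intro AE_I2 iexp1)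
      show "AE q in Q. (\<lambda>m. \<integral>w. iexp (\<Sum>l\<in>K. c q l * V m l w) \<partial>P) \<longlonglongrightarrow> (\<integral>w. iexp (\<Sum>l\<in>K. c q l * S l w) \<partial>Q)"
        unfolding Sg using asymp_gaussian_tendsto[OF Vg] by auto
    qed simp
    ultimately show ?thesis by simp
  qed
  show ?thesis
  proof (rule tendstoI)
    fix e :: real assume e: "e > 0"
    obtain N where N: "\<And>n m. n \<ge> N \<Longrightarrow> m \<ge> 1 \<Longrightarrow> norm (\<Phi> n m - (\<integral>w. \<psi> m w \<partial>P)) < e / 2"
      using unif[of "e / 2"] e by auto
    obtain N' where N': "\<And>m. m \<ge> N' \<Longrightarrow> norm ((\<integral>w. \<psi> m w \<partial>P) - \<Lambda>) < e / 2"
      using LIMSEQ_D[OF lim, of "e / 2"] e by auto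
    \<comment> \<open>\<open>N\<close> does not depend on \<open>m\<close>, so a single threshold
      serves both coordinates.\<close>
    have "dist (\<Phi> n m) \<Lambda> < e" if "n \<ge> max N (max N' 1)" "m \<ge> max N (max N' 1)" for n m
      using N[of n m] N'[of m] that norm_triangle_ineq[of "\<Phi> n m - (\<integral>w. \<psi> m w \<partial>P)" "(\<integral>w. \<psi> m w \<partial>P) - \<Lambda>"]
      by (simp add: dist_norm)
    then show "\<forall>\<^sub>F x in sequentially \<times>\<^sub>F sequentially. dist (case x of (n, m) \<Rightarrow>
        \<integral>w. iexp (\<Sum>k\<in>K. \<Sum>l\<in>K. a k l * U n k w * V m l w) \<partial>P)
        (\<integral>q. iexp (\<Sum>k\<in>K. \<Sum>l\<in>K. a k l * T k q * S l q) \<partial>Q) < e"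
      unfolding eventually_prod_sequentially \<Phi>_def[symmetric] \<Lambda>_def[symmetric] prod.case by blast
  qed
qed

section \<open>Truncation for two independent samples\<close>

text \<open>The samples may have different value types, whereas \<open>indep_var\<close> asks for a
  common one; independence of the whole sequences is therefore encoded by the sigma-algebras they
  generate.\<close>

locale two_samples = X: orthonormal_sample P mu xi I g + Y: orthonormal_sample P nu eta I h
  for P :: "'w measure" and mu :: "'a measure" and nu :: "'b measure"
    and xi eta and I :: "'i set" and g h +
  assumes indep: "X.indep_set
          {(\<lambda>w. restrict (\<lambda>i. xi i w) {1..}) -` A \<inter> space P | A. A \<in> sets (Pi\<^sub>M {1..} (\<lambda>_. mu))}
          {(\<lambda>w. restrict (\<lambda>j. eta j w) {1..}) -` B \<inter> space P | B. B \<in> sets (Pi\<^sub>M {1..} (\<lambda>_. nu))}"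
begin

text \<open>Preimages under \<open>U\<close> and \<open>V\<close> are preimages under the whole
  sequences, so independence factorises the measure of rectangles, which determine the product
  measure. With \<open>S\<close> and \<open>T\<close> arbitrary it covers both vectors of normalised
  sums and single pairs \<open>(xi i w, eta j w)\<close>.\<close>

lemma joint_distr:
  assumes F: "F \<in> measurable (Pi\<^sub>M {1..} (\<lambda>_. mu)) S" and G: "G \<in> measurable (Pi\<^sub>M {1..} (\<lambda>_. nu)) T"
  defines "U \<equiv> (\<lambda>w. F (restrict (\<lambda>i. xi i w) {1..}))" and "V \<equiv> (\<lambda>w. G (restrict (\<lambda>j. eta j w) {1..}))"
  shows "U \<in> measurable P S" and "V \<in> measurable P T"
    and "distr P S U \<Otimes>\<^sub>M distr P T V = distr P (S \<Otimes>\<^sub>M T) (\<lambda>w. (U w, V w))"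
proof -
  have rx: "(\<lambda>w. restrict (\<lambda>i. xi i w) {1..}) \<in> measurable P (Pi\<^sub>M {1..} (\<lambda>_. mu))"
    by (intro measurable_restrict X.X_meas) simp
  have ry: "(\<lambda>w. restrict (\<lambda>i. eta i w) {1..}) \<in> measurable P (Pi\<^sub>M {1..} (\<lambda>_. nu))"
    by (intro measurable_restrict Y.X_meas) simp
  show U: "U \<in> measurable P S" unfolding U_def by (rule measurable_compose[OF rx F])
  show V: "V \<in> measurable P T" unfolding V_def by (rule measurable_compose[OF ry G])
  interpret U: prob_space "distr P S U" by (rule X.prob_space_distr) fact
  interpret V: prob_space "distr P T V" by (rule X.prob_space_distr) fact
  show "distr P S U \<Otimes>\<^sub>M distr P T V = distr P (S \<Otimes>\<^sub>M T) (\<lambda>w. (U w, V w))"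
  proof (rule pair_measure_eqI)
    fix A B assume "A \<in> sets (distr P S U)" "B \<in> sets (distr P T V)"
    then have A: "A \<in> sets S" and B: "B \<in> sets T" by auto
    have "U -` A \<inter> space P = (\<lambda>w. restrict (\<lambda>i. xi i w) {1..}) -` (F -` A \<inter> space (Pi\<^sub>M {1..} (\<lambda>_. mu))) \<inter> space P"
      using measurable_space[OF rx] by (auto simp: U_def)
    moreover have "V -` B \<inter> space P = (\<lambda>w. restrict (\<lambda>i. eta i w) {1..}) -` (G -` B \<inter> space (Pi\<^sub>M {1..} (\<lambda>_. nu))) \<inter> space P"
      using measurable_space[OF ry] by (auto simp: V_def)
    ultimately have "X.prob ((U -` A \<inter> space P) \<inter> (V -` B \<inter> space P)) = X.prob (U -` A \<inter> space P) * X.prob (V -` B \<inter> space P)"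
      using measurable_sets[OF F A] measurable_sets[OF G B] by (intro X.indep_setD[OF indep]) blast+
    moreover have "(\<lambda>w. (U w, V w)) -` (A \<times> B) \<inter> space P = (U -` A \<inter> space P) \<inter> (V -` B \<inter> space P)"
      by auto
    ultimately show "emeasure (distr P S U) A * emeasure (distr P T V) B
        = emeasure (distr P (S \<Otimes>\<^sub>M T) (\<lambda>w. (U w, V w))) (A \<times> B)"
      using A B U V by (simp add: emeasure_distr X.emeasure_eq_measure ennreal_mult[symmetric])
  qed (simp_all add: U.sigma_finite_measure_axioms V.sigma_finite_measure_axioms cong: sets_pair_measure_cong)
qed

text \<open>Each vector of normalised sums is a measurable function \<open>F\<close> or
  \<open>G\<close> of one entire sequence.\<close>

lemma nsum_vec_indep:
  assumes K: "K \<subseteq> I"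
  shows "X.indep_var (Pi\<^sub>M K (\<lambda>_. borel)) (\<lambda>w. restrict (\<lambda>k. X.nsum n k w) K)
    (Pi\<^sub>M K (\<lambda>_. borel)) (\<lambda>w. restrict (\<lambda>k. Y.nsum m k w) K)"
proof -
  define F where "F = (\<lambda>x. \<lambda>k\<in>K. (\<Sum>i=1..n. g k (x i)) / sqrt n)"
  define G where "G = (\<lambda>x. \<lambda>k\<in>K. (\<Sum>i=1..m. h k (x i)) / sqrt m)"
  have F: "F \<in> measurable (Pi\<^sub>M {1..} (\<lambda>_. mu)) (Pi\<^sub>M K (\<lambda>_. borel))"
    unfolding F_def using K
    by (intro measurable_restrict borel_measurable_divide borel_measurable_const borel_measurable_sum
        measurable_compose[OF _ X.u_meas]) auto
  have G: "G \<in> measurable (Pi\<^sub>M {1..} (\<lambda>_. nu)) (Pi\<^sub>M K (\<lambda>_. borel))"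
    unfolding G_def using K
    by (intro measurable_restrict borel_measurable_divide borel_measurable_const borel_measurable_sum
        measurable_compose[OF _ Y.u_meas]) auto
  have "F (restrict (\<lambda>i. xi i w) {1..}) = restrict (\<lambda>k. X.nsum n k w) K"
    and "G (restrict (\<lambda>i. eta i w) {1..}) = restrict (\<lambda>k. Y.nsum m k w) K" for w
  proof -
    have "(\<Sum>i=1..n. g k (restrict (\<lambda>i. xi i w) {1..} i)) = (\<Sum>i=1..n. g k (xi i w))"
      and "(\<Sum>i=1..m. h k (restrict (\<lambda>i. eta i w) {1..} i)) = (\<Sum>i=1..m. h k (eta i w))" for k
      by (intro sum.cong; simp)+
    then show "F (restrict (\<lambda>i. xi i w) {1..}) = restrict (\<lambda>k. X.nsum n k w) K"
      and "G (restrict (\<lambda>i. eta i w) {1..}) = restrict (\<lambda>k. Y.nsum m k w) K"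
      unfolding F_def G_def X.nsum_def Y.nsum_def by (simp_all only:)
  qed
  then show ?thesis
    using joint_distr[OF F G] by (simp add: X.indep_var_distribution_eq)
qed

lemma pair_law:
  assumes i: "i \<ge> 1" and j: "j \<ge> 1"
  shows "distr P (mu \<Otimes>\<^sub>M nu) (\<lambda>w. (xi i w, eta j w)) = mu \<Otimes>\<^sub>M nu"
  using joint_distr(3)[of "\<lambda>x. x i" mu "\<lambda>x. x j" nu] X.X_law[OF i] Y.X_law[OF j] i j by simp

lemma pair_meas:
  assumes "i \<ge> 1" "j \<ge> 1"
  shows "(\<lambda>w. (xi i w, eta j w)) \<in> measurable P (mu \<Otimes>\<^sub>M nu)"
  using X.X_meas[OF assms(1)] Y.X_meas[OF assms(2)] by measurable

lemma SL_meas: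
  assumes r: "(\<lambda>z. r (fst z) (snd z)) \<in> borel_measurable (mu \<Otimes>\<^sub>M nu)"
    and L: "L \<subseteq> {1..} \<times> {1..}"
  shows "SL r xi eta L \<in> borel_measurable P"
proof -
  have "(\<lambda>w. case l of (i, j) \<Rightarrow> r (xi i w) (eta j w)) \<in> borel_measurable P" if "l \<in> L" for l
    using measurable_compose[OF pair_meas r, of "fst l" "snd l"] that L by (auto simp: case_prod_beta')
  then show ?thesis
    unfolding SL_def by measurable
qed

text \<open>A crude Cauchy-Schwarz bound that uses no orthogonality, hence valid for the remainder
  of \<open>f\<close>, known only through its L2 norm. The factor \<open>card L\<close> is harmless
  because \<open>L\<close> stays fixed while the truncation level grows.\<close>

lemma SL_second_moment:
  assumes r: "(\<lambda>z. r (fst z) (snd z)) \<in> borel_measurable (mu \<Otimes>\<^sub>M nu)"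
    and L: "finite L" "L \<subseteq> {1..} \<times> {1..}"
  shows "(\<integral>\<^sup>+w. ennreal ((SL r xi eta L w)\<^sup>2) \<partial>P)
    \<le> of_nat (card L) * (\<integral>\<^sup>+z. ennreal ((r (fst z) (snd z))\<^sup>2) \<partial>(mu \<Otimes>\<^sub>M nu))"
proof -
  define q where "q l w = r (xi (fst l) w) (eta (snd l) w)" for l w
  have qm: "q l \<in> borel_measurable P" if "l \<in> L" for l
    unfolding q_def using measurable_compose[OF pair_meas r, of "fst l" "snd l"] that L by auto
  have "(SL r xi eta L w)\<^sup>2 \<le> (\<Sum>l\<in>L. (q l w)\<^sup>2)" for w
  proof (cases "L = {}")
    case False
    then have c: "card L > 0" using L by auto
    have "(SL r xi eta L w)\<^sup>2 = (\<Sum>l\<in>L. 1 * q l w)\<^sup>2 / card L"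
      by (simp add: SL_def q_def power_divide case_prod_beta')
    also have "\<dots> \<le> ((\<Sum>l\<in>L. 1\<^sup>2) * (\<Sum>l\<in>L. (q l w)\<^sup>2)) / card L"
      by (intro divide_right_mono Cauchy_Schwarz_ineq_sum) simp
    finally show ?thesis using c by simp
  qed (simp add: SL_def)
  then have "(\<integral>\<^sup>+w. ennreal ((SL r xi eta L w)\<^sup>2) \<partial>P) \<le> (\<integral>\<^sup>+w. (\<Sum>l\<in>L. ennreal ((q l w)\<^sup>2)) \<partial>P)"
    by (intro nn_integral_mono) (auto simp: sum_ennreal intro!: ennreal_leI)
  also have "\<dots> = (\<Sum>l\<in>L. \<integral>\<^sup>+w. ennreal ((q l w)\<^sup>2) \<partial>P)"
    using qm by (intro nn_integral_sum) measurable
  also have "\<dots> = (\<Sum>l\<in>L. \<integral>\<^sup>+z. ennreal ((r (fst z) (snd z))\<^sup>2) \<partial>(mu \<Otimes>\<^sub>M nu))"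
  proof (intro sum.cong refl)
    fix l assume "l \<in> L"
    then have l: "fst l \<ge> 1" "snd l \<ge> 1" using L by auto
    show "(\<integral>\<^sup>+w. ennreal ((q l w)\<^sup>2) \<partial>P) = (\<integral>\<^sup>+z. ennreal ((r (fst z) (snd z))\<^sup>2) \<partial>(mu \<Otimes>\<^sub>M nu))"
      using nn_integral_distr[OF pair_meas[OF l], of "\<lambda>z. ennreal ((r (fst z) (snd z))\<^sup>2)"] r
      by (simp add: pair_law[OF l] q_def)
  qed
  finally show ?thesis by simp
qed

text \<open>On a rectangle the double sum factorises, and \<open>1 / sqrt (n * m)\<close> splits
  into the two normalisations.\<close>

lemma SL_bilinear:
  "SL (\<lambda>x y. \<Sum>k\<in>K. \<Sum>l\<in>K. lam k l * g k x * h l y) xi eta ({1..n} \<times> {1..m}) w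
    = (\<Sum>k\<in>K. \<Sum>l\<in>K. lam k l * X.nsum n k w * Y.nsum m l w)"
proof -
  have "(\<Sum>(i, j)\<in>{1..n} \<times> {1..m}. \<Sum>k\<in>K. \<Sum>l\<in>K. lam k l * g k (xi i w) * h l (eta j w))
      = (\<Sum>k\<in>K. \<Sum>l\<in>K. \<Sum>(i, j)\<in>{1..n} \<times> {1..m}. lam k l * g k (xi i w) * h l (eta j w))"
    unfolding case_prod_beta'
    by (subst sum.swap, intro sum.cong refl, subst sum.swap, simp)
  also have "\<dots> = (\<Sum>k\<in>K. \<Sum>l\<in>K. lam k l * (\<Sum>i\<in>{1..n}. g k (xi i w)) * (\<Sum>j\<in>{1..m}. h l (eta j w)))"
    by (intro sum.cong refl)
      (simp add: sum.cartesian_product[symmetric] sum_distrib_left sum_distrib_right mult.assoc, subst sum.swap, simp)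
  finally have *: "(\<Sum>(i, j)\<in>{1..n} \<times> {1..m}. \<Sum>k\<in>K. \<Sum>l\<in>K. lam k l * g k (xi i w) * h l (eta j w))
      = (\<Sum>k\<in>K. \<Sum>l\<in>K. lam k l * (\<Sum>i\<in>{1..n}. g k (xi i w)) * (\<Sum>j\<in>{1..m}. h l (eta j w)))" .
  have "(\<Sum>k\<in>K. \<Sum>l\<in>K. lam k l * X.nsum n k w * Y.nsum m l w)
      = 1 / sqrt (real (card ({1..n} \<times> {1..m})))
        * (\<Sum>k\<in>K. \<Sum>l\<in>K. lam k l * (\<Sum>i\<in>{1..n}. g k (xi i w)) * (\<Sum>j\<in>{1..m}. h l (eta j w)))"
    by (simp add: X.nsum_def Y.nsum_def sum_divide_distrib[where A = K] real_sqrt_mult)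
  then show ?thesis
    unfolding SL_def * by (rule sym)
qed

lemma SL_diff: "SL r xi eta L w - SL r' xi eta L w = SL (\<lambda>x y. r x y - r' x y) xi eta L w"
  by (simp add: SL_def case_prod_beta' sum_subtractf diff_divide_distrib)

text \<open>Independence of the two vectors splits the expectation of four factors into two
  covariances, each of which is an entry of the identity matrix.\<close>

lemma nsum_prod_orthonormal:
  assumes p: "p \<in> I \<times> I" "p' \<in> I \<times> I" and n: "n \<ge> 1" "m \<ge> 1"
  defines "Z \<equiv> (\<lambda>p w. X.nsum n (fst p) w * Y.nsum m (snd p) w)"
  shows "integrable P (\<lambda>w. Z p w * Z p' w)"
    and "(\<integral>w. Z p w * Z p' w \<partial>P) = (if p = p' then 1 else 0)"
proof -
  have k: "fst p \<in> I" "fst p' \<in> I" "snd p \<in> I" "snd p' \<in> I" using p by auto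
  define G where "G w = X.nsum n (fst p) w * X.nsum n (fst p') w" for w
  define H where "H w = Y.nsum m (snd p) w * Y.nsum m (snd p') w" for w
  have eq: "Z p w * Z p' w = G w * H w" for w by (simp add: Z_def G_def H_def)
  have "X.indep_var borel ((\<lambda>x. x (fst p) * x (fst p')) \<circ> (\<lambda>w. restrict (\<lambda>k. X.nsum n k w) I))
    borel ((\<lambda>x. x (snd p) * x (snd p')) \<circ> (\<lambda>w. restrict (\<lambda>k. Y.nsum m k w) I))"
    using k by (intro X.indep_var_compose[OF nsum_vec_indep[OF order_refl]]) measurable
  then have ind: "X.indep_var borel G borel H"
    using k by (simp add: comp_def G_def[abs_def] H_def[abs_def])
  have Gi: "integrable P G" and Hi: "integrable P H"
    unfolding G_def H_def using k n by (auto intro!: X.nsum_prod Y.nsum_prod)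
  show "integrable P (\<lambda>w. Z p w * Z p' w)"
    unfolding eq by (rule X.indep_var_integrable[OF ind Gi Hi])
  have "(\<integral>w. Z p w * Z p' w \<partial>P) = (\<integral>w. G w \<partial>P) * (\<integral>w. H w \<partial>P)"
    unfolding eq by (rule X.indep_var_lebesgue_integral[OF ind Gi Hi])
  then show "(\<integral>w. Z p w * Z p' w \<partial>P) = (if p = p' then 1 else 0)"
    using X.nsum_prod(2)[OF k(1,2) n(1)] Y.nsum_prod(2)[OF k(3,4) n(2)]
    by (simp add: G_def H_def prod_eq_iff)
qed

lemma truncated_second_moment:
  assumes J: "finite J" "J \<subseteq> I \<times> I" and n: "n \<ge> 1" "m \<ge> 1"
  shows "(\<integral>\<^sup>+w. ennreal ((\<Sum>p\<in>J. lam p * (X.nsum n (fst p) w * Y.nsum m (snd p) w))\<^sup>2) \<partial>P)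
    = ennreal (\<Sum>p\<in>J. (lam p)\<^sup>2)"
proof -
  define Z where "Z p w = X.nsum n (fst p) w * Y.nsum m (snd p) w" for p w
  have "integrable P (\<lambda>w. Z p w * Z p' w)"
    and "(\<integral>w. Z p w * Z p' w \<partial>P) = (if p = p' then 1 else 0)" if "p \<in> J" "p' \<in> J" for p p'
    unfolding Z_def using nsum_prod_orthonormal[OF _ _ n, of p p'] that J(2) by blast+
  from orthonormal_sum[OF J(1) this, where a = lam] show ?thesis
    unfolding Z_def by (simp add: nn_integral_eq_integral)
qed

text \<open>The error at level \<open>N\<close> is split at a higher level \<open>N'\<close>. Beyond
  \<open>N'\<close> the crude bound, with its factor \<open>card L\<close>, vanishes as
  \<open>N'\<close> grows; between the levels orthonormality gives at most \<open>s - S N\<close>.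
  The result is free of \<open>n\<close> and \<open>m\<close>, and \<open>s\<close> may be any bound
  of the partial sums.\<close>

lemma truncation_error:
  fixes lam :: "'i \<Rightarrow> 'i \<Rightarrow> real" and K :: "nat \<Rightarrow> 'i set"
  assumes K: "\<And>N. finite (K N)" "\<And>N. K N \<subseteq> I" "incseq K"
    and s: "\<And>N. (\<Sum>p\<in>K N \<times> K N. (lam (fst p) (snd p))\<^sup>2) \<le> s"
    and f: "(\<lambda>z. f (fst z) (snd z)) \<in> borel_measurable (mu \<Otimes>\<^sub>M nu)"
    and lim: "(\<lambda>N. \<integral>\<^sup>+ z. ennreal ((f (fst z) (snd z)
          - (\<Sum>k\<in>K N. \<Sum>l\<in>K N. lam k l * g k (fst z) * h l (snd z)))\<^sup>2) \<partial>(mu \<Otimes>\<^sub>M nu)) \<longlonglongrightarrow> 0"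
    and n: "n \<ge> 1" "m \<ge> 1"
  shows "(\<integral>\<^sup>+w. ennreal ((SL f xi eta ({1..n} \<times> {1..m}) w
      - (\<Sum>k\<in>K N. \<Sum>l\<in>K N. lam k l * X.nsum n k w * Y.nsum m l w))\<^sup>2) \<partial>P)
    \<le> ennreal (2 * (s - (\<Sum>p\<in>K N \<times> K N. (lam (fst p) (snd p))\<^sup>2)))"
proof -
  define L where "L = {1..n} \<times> {1..m}"
  define B where "B N w = (\<Sum>k\<in>K N. \<Sum>l\<in>K N. lam k l * X.nsum n k w * Y.nsum m l w)" for N w
  define fN where "fN N x y = (\<Sum>k\<in>K N. \<Sum>l\<in>K N. lam k l * g k x * h l y)" for N x y
  define E where "E N = (\<integral>\<^sup>+ z. ennreal ((f (fst z) (snd z) - fN N (fst z) (snd z))\<^sup>2) \<partial>(mu \<Otimes>\<^sub>M nu))" for N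
  define S where "S N = (\<Sum>p\<in>K N \<times> K N. (lam (fst p) (snd p))\<^sup>2)" for N
  have L: "finite L" "L \<subseteq> {1..} \<times> {1..}" by (auto simp: L_def)
  have gm: "(\<lambda>z. g k (fst z)) \<in> borel_measurable (mu \<Otimes>\<^sub>M nu)"
    and hm: "(\<lambda>z. h k (snd z)) \<in> borel_measurable (mu \<Otimes>\<^sub>M nu)" if "k \<in> K N" for k N
    using measurable_compose[OF measurable_fst X.u_meas] measurable_compose[OF measurable_snd Y.u_meas] K(2) that by blast+
  have fNm: "(\<lambda>z. fN N (fst z) (snd z)) \<in> borel_measurable (mu \<Otimes>\<^sub>M nu)" for N
    unfolding fN_def using gm hm
    by (intro borel_measurable_sum borel_measurable_times borel_measurable_const) auto
  have Bm: "B N \<in> borel_measurable P" for N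
    unfolding B_def using K(2)
    by (intro borel_measurable_sum borel_measurable_times borel_measurable_const X.nsum_meas Y.nsum_meas) auto
  have SLm: "SL f xi eta L \<in> borel_measurable P" by (rule SL_meas[OF f L(2)])
  have BSL: "B N w = SL (fN N) xi eta L w" for N w
    unfolding B_def fN_def[abs_def] L_def by (rule SL_bilinear[symmetric])
  have bound: "(\<integral>\<^sup>+w. ennreal ((SL f xi eta L w - B N w)\<^sup>2) \<partial>P)
    \<le> (2 * of_nat (card L)) * E N' + ennreal (2 * (s - S N))" if N': "N' \<ge> N" for N'
  proof -
    have sub: "K N \<times> K N \<subseteq> K N' \<times> K N'" using incseqD[OF K(3) N'] by auto
    have "(\<integral>\<^sup>+w. ennreal ((SL f xi eta L w - B N w)\<^sup>2) \<partial>P)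
      \<le> (\<integral>\<^sup>+w. 2 * ennreal ((SL f xi eta L w - B N' w)\<^sup>2) + 2 * ennreal ((B N' w - B N w)\<^sup>2) \<partial>P)"
    proof (rule nn_integral_mono)
      fix w
      \<comment> \<open>The source of the factor 2 in the final bound.\<close>
      have "(a - c)\<^sup>2 \<le> 2 * (a - b)\<^sup>2 + 2 * (b - c)\<^sup>2" for a b c :: real
        using zero_le_power2[of "(a - b) - (b - c)"] by (simp add: power2_eq_square algebra_simps)
      then have "ennreal ((SL f xi eta L w - B N w)\<^sup>2)
        \<le> ennreal (2 * (SL f xi eta L w - B N' w)\<^sup>2 + 2 * (B N' w - B N w)\<^sup>2)"
        by (intro ennreal_leI)
      then show "ennreal ((SL f xi eta L w - B N w)\<^sup>2)
        \<le> 2 * ennreal ((SL f xi eta L w - B N' w)\<^sup>2) + 2 * ennreal ((B N' w - B N w)\<^sup>2)"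
        by (simp add: ennreal_plus ennreal_mult)
    qed
    also have "\<dots> = 2 * (\<integral>\<^sup>+w. ennreal ((SL f xi eta L w - B N' w)\<^sup>2) \<partial>P)
        + 2 * (\<integral>\<^sup>+w. ennreal ((B N' w - B N w)\<^sup>2) \<partial>P)"
      using SLm Bm by (subst nn_integral_add; (subst nn_integral_cmult)?; measurable?) (simp add: nn_integral_cmult)
    also have "(\<integral>\<^sup>+w. ennreal ((SL f xi eta L w - B N' w)\<^sup>2) \<partial>P) \<le> of_nat (card L) * E N'"
      unfolding BSL SL_diff E_def
      using f fNm by (intro SL_second_moment L borel_measurable_diff)
    also have "(\<integral>\<^sup>+w. ennreal ((B N' w - B N w)\<^sup>2) \<partial>P) = ennreal (S N' - S N)"
    proof -
      have B: "B N w = (\<Sum>p\<in>K N \<times> K N. lam (fst p) (snd p) * (X.nsum n (fst p) w * Y.nsum m (snd p) w))" for N w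
        unfolding B_def by (simp add: sum.cartesian_product case_prod_beta' mult.assoc)
      \<comment> \<open>The two truncations differ by the index pairs in
        \<open>K N' \<times> K N'\<close> outside \<open>K N \<times> K N\<close>, again a finite
        orthonormal sum.\<close>
      have "B N' w - B N w = (\<Sum>p\<in>K N' \<times> K N' - K N \<times> K N. lam (fst p) (snd p) * (X.nsum n (fst p) w * Y.nsum m (snd p) w))" for w
        unfolding B using K(1) sub by (subst sum_diff) auto
      then have "(\<integral>\<^sup>+w. ennreal ((B N' w - B N w)\<^sup>2) \<partial>P)
        = ennreal (\<Sum>p\<in>K N' \<times> K N' - K N \<times> K N. (lam (fst p) (snd p))\<^sup>2)"
        using truncated_second_moment[of "K N' \<times> K N' - K N \<times> K N" n m "\<lambda>p. lam (fst p) (snd p)"] K(1) K(2) n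
        by fastforce
      also have "\<dots> = ennreal (S N' - S N)"
        unfolding S_def using K(1) sub by (subst sum_diff) auto
      finally show ?thesis .
    qed
    also have "ennreal (S N' - S N) \<le> ennreal (s - S N)"
      using s[of N'] by (intro ennreal_leI) (simp add: S_def)
    finally have "(\<integral>\<^sup>+w. ennreal ((SL f xi eta L w - B N w)\<^sup>2) \<partial>P)
      \<le> 2 * (of_nat (card L) * E N') + 2 * ennreal (s - S N)"
      by (simp add: add_mono mult_left_mono)
    moreover have "2 * ennreal (s - S N) = ennreal (2 * (s - S N))"
      by (subst ennreal_mult') simp_all
    ultimately show ?thesis by (simp only: mult.assoc)
  qed
  \<comment> \<open>With \<open>N\<close> and \<open>L\<close> fixed, \<open>N'\<close> tends to
    infinity and removes the term carrying \<open>card L\<close>.\<close>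
  have "(\<lambda>N'. (2 * of_nat (card L)) * E N' + ennreal (2 * (s - S N))) \<longlonglongrightarrow> (2 * of_nat (card L)) * 0 + ennreal (2 * (s - S N))"
    using lim unfolding E_def fN_def
    by (intro tendsto_add tendsto_const ennreal_tendsto_cmult) (auto simp: ennreal_mult_less_top of_nat_less_top)
  then have "(\<integral>\<^sup>+w. ennreal ((SL f xi eta L w - B N w)\<^sup>2) \<partial>P) \<le> (2 * of_nat (card L)) * 0 + ennreal (2 * (s - S N))"
    by (rule LIMSEQ_le_const) (use bound in blast)
  then show ?thesis by (simp add: L_def B_def S_def)
qed

end

section \<open>Convergence in distribution\<close>

text \<open>Levy's continuity theorem concerns sequences of laws, so the double limit is tested
  along sequences \<open>p\<close>. If it failed, points with both coordinates at least
  \<open>N\<close> could be chosen for each \<open>N\<close> to form a sequence violating the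
  assumption.\<close>

lemma tendsto_prod_sequentiallyI:
  fixes F :: "nat \<times> nat \<Rightarrow> 'c::metric_space"
  assumes "\<And>p. filterlim p (sequentially \<times>\<^sub>F sequentially) sequentially \<Longrightarrow> (\<lambda>j. F (p j)) \<longlonglongrightarrow> L"
  shows "(F \<longlongrightarrow> L) (sequentially \<times>\<^sub>F sequentially)"
proof (rule tendstoI, rule ccontr)
  fix e :: real assume e: "e > 0" and n: "\<not> (\<forall>\<^sub>F x in sequentially \<times>\<^sub>F sequentially. dist (F x) L < e)"
  have "\<exists>x. fst x \<ge> N \<and> snd x \<ge> N \<and> \<not> dist (F x) L < e" for N
    using n unfolding eventually_prod_sequentially by force
  then obtain p where p: "\<And>N. fst (p N) \<ge> N \<and> snd (p N) \<ge> N \<and> \<not> dist (F (p N)) L < e"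
    by metis
  have "filterlim (\<lambda>N. (fst (p N), snd (p N))) (sequentially \<times>\<^sub>F sequentially) sequentially"
    by (intro filterlim_Pair filterlim_at_top_mono[OF filterlim_ident] always_eventually) (auto simp: p)
  then have "(\<lambda>j. F (p j)) \<longlonglongrightarrow> L" using assms by simp
  from tendstoD[OF this e] p show False by (auto simp: eventually_sequentially)
qed

theorem theorem4p1:
  fixes mu :: "'a measure" and nu :: "'b measure" and P :: "'w measure"
    and xi :: "nat \<Rightarrow> 'w \<Rightarrow> 'a" and eta :: "nat \<Rightarrow> 'w \<Rightarrow> 'b"
    and f :: "'a \<Rightarrow> 'b \<Rightarrow> real" and M :: enat
    and lam :: "nat \<Rightarrow> nat \<Rightarrow> real" and g :: "nat \<Rightarrow> 'a \<Rightarrow> real" and h :: "nat \<Rightarrow> 'b \<Rightarrow> real"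
    and Q :: "'q measure" and tau :: "nat \<Rightarrow> 'q \<Rightarrow> real" and theta :: "nat \<Rightarrow> 'q \<Rightarrow> real"
    and Sinf :: "'q \<Rightarrow> real"
  assumes mu: "prob_space mu" and nu: "prob_space nu"
    and P: "prob_space P"
    and xi_meas: "\<And>i. i \<ge> 1 \<Longrightarrow> xi i \<in> measurable P mu"
    and xi_law: "\<And>i. i \<ge> 1 \<Longrightarrow> distr P mu (xi i) = mu"
    and eta_meas: "\<And>j. j \<ge> 1 \<Longrightarrow> eta j \<in> measurable P nu"
    and eta_law: "\<And>j. j \<ge> 1 \<Longrightarrow> distr P nu (eta j) = nu"
    and xi_indep: "prob_space.indep_vars P (\<lambda>_. mu) xi {1..}"
    and eta_indep: "prob_space.indep_vars P (\<lambda>_. nu) eta {1..}"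
    and xi_eta_indep: "prob_space.indep_set P
          {(\<lambda>w. restrict (\<lambda>i. xi i w) {1..}) -` A \<inter> space P | A. A \<in> sets (Pi\<^sub>M {1..} (\<lambda>_. mu))}
          {(\<lambda>w. restrict (\<lambda>j. eta j w) {1..}) -` B \<inter> space P | B. B \<in> sets (Pi\<^sub>M {1..} (\<lambda>_. nu))}"
    and M: "M \<ge> 1"
    and g_meas: "\<And>k. k \<in> idx M \<Longrightarrow> g k \<in> borel_measurable mu"
    and h_meas: "\<And>l. l \<in> idx M \<Longrightarrow> h l \<in> borel_measurable nu"
    and g_int: "\<And>k. k \<in> idx M \<Longrightarrow> integrable mu (g k)"
    and h_int: "\<And>l. l \<in> idx M \<Longrightarrow> integrable nu (h l)"
    and g_centered: "\<And>k. k \<in> idx M \<Longrightarrow> (\<integral>x. g k x \<partial>mu) = 0"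
    and h_centered: "\<And>l. l \<in> idx M \<Longrightarrow> (\<integral>y. h l y \<partial>nu) = 0"
    and g_orth_int: "\<And>k k'. k \<in> idx M \<Longrightarrow> k' \<in> idx M \<Longrightarrow> integrable mu (\<lambda>x. g k x * g k' x)"
    and h_orth_int: "\<And>l l'. l \<in> idx M \<Longrightarrow> l' \<in> idx M \<Longrightarrow> integrable nu (\<lambda>y. h l y * h l' y)"
    and g_orth: "\<And>k k'. k \<in> idx M \<Longrightarrow> k' \<in> idx M \<Longrightarrow>
                   (\<integral>x. g k x * g k' x \<partial>mu) = (if k = k' then 1 else 0)"
    and h_orth: "\<And>l l'. l \<in> idx M \<Longrightarrow> l' \<in> idx M \<Longrightarrow>
                   (\<integral>y. h l y * h l' y \<partial>nu) = (if l = l' then 1 else 0)"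
    and lam_summable: "(\<lambda>(k, l). (lam k l)\<^sup>2) summable_on (idx M \<times> idx M)"
    and sigma_pos: "(\<Sum>\<^sub>\<infinity>(k, l)\<in>idx M \<times> idx M. (lam k l)\<^sup>2) > 0"
    and f_meas: "(\<lambda>z. f (fst z) (snd z)) \<in> borel_measurable (mu \<Otimes>\<^sub>M nu)"
    and f_expansion: "(\<lambda>N. \<integral>\<^sup>+ z. ennreal ((f (fst z) (snd z)
          - (\<Sum>k\<in>idx M \<inter> {..N}. \<Sum>l\<in>idx M \<inter> {..N}. lam k l * g k (fst z) * h l (snd z)))\<^sup>2)
          \<partial>(mu \<Otimes>\<^sub>M nu)) \<longlonglongrightarrow> 0"
    and W_pos: "0 < Wf 2 mu nu f" and W_fin: "Wf 2 mu nu f < \<infinity>"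
    and Q: "prob_space Q"
    and tau_normal: "\<And>k. k \<in> idx M \<Longrightarrow> distributed Q lborel (tau k) (\<lambda>x. ennreal (std_normal_density x))"
    and theta_normal: "\<And>l. l \<in> idx M \<Longrightarrow> distributed Q lborel (theta l) (\<lambda>x. ennreal (std_normal_density x))"
    and tau_indep: "prob_space.indep_vars Q (\<lambda>_. borel) tau (idx M)"
    and theta_indep: "prob_space.indep_vars Q (\<lambda>_. borel) theta (idx M)"
    and tau_theta_indep: "prob_space.indep_var Q
          (Pi\<^sub>M (idx M) (\<lambda>_. borel)) (\<lambda>w. restrict (\<lambda>k. tau k w) (idx M))
          (Pi\<^sub>M (idx M) (\<lambda>_. borel)) (\<lambda>w. restrict (\<lambda>l. theta l w) (idx M))"
    and Sinf_meas: "Sinf \<in> borel_measurable Q"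
    and Sinf_def: "(\<lambda>N. \<integral>\<^sup>+ w. ennreal ((Sinf w
          - (\<Sum>k\<in>idx M \<inter> {..N}. \<Sum>l\<in>idx M \<inter> {..N}. lam k l * tau k w * theta l w))\<^sup>2) \<partial>Q)
          \<longlonglongrightarrow> 0"
  shows "\<forall>\<phi> :: real \<Rightarrow> real. continuous_on UNIV \<phi> \<and> bounded (range \<phi>) \<longrightarrow>
     ((\<lambda>(n1, n2). \<integral>w. \<phi> (SL f xi eta ({1..n1} \<times> {1..n2}) w) \<partial>P)
        \<longlongrightarrow> (\<integral>w. \<phi> (Sinf w) \<partial>Q)) (at_top \<times>\<^sub>F at_top)"
proof -
  interpret P: prob_space P by fact
  interpret Q: prob_space Q by fact
  define I where "I = idx M"
  interpret S: two_samples P mu nu xi eta I g h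
  proof (intro two_samples.intro orthonormal_sample.intro orthonormal_sample_axioms.intro two_samples_axioms.intro)
  qed (unfold I_def, fact+)
  define K where "K N = I \<inter> {..N}" for N
  define BS where "BS N = (\<Sum>p\<in>K N \<times> K N. (lam (fst p) (snd p))\<^sup>2)" for N
  define SK where "SK N n m w = (\<Sum>k\<in>K N. \<Sum>l\<in>K N. lam k l * S.X.nsum n k w * S.Y.nsum m l w)" for N n m w
  define GK where "GK N q = (\<Sum>k\<in>K N. \<Sum>l\<in>K N. lam k l * tau k q * theta l q)" for N q
  define SLf where "SLf = (\<lambda>(n1, n2). SL f xi eta ({1..n1} \<times> {1..n2}))"
  have K: "finite (K N)" "K N \<subseteq> I" "incseq K" for N
    by (auto simp: K_def incseq_def)
  have BS_inc: "incseq BS"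
    unfolding BS_def incseq_def using incseqD[OF K(3)] K(1) by (auto intro!: sum_mono2)
  have BS_le: "BS N \<le> (\<Sum>\<^sub>\<infinity>(k, l)\<in>I \<times> I. (lam k l)\<^sup>2)" for N
    unfolding BS_def case_prod_beta'
    using lam_summable K(1,2) unfolding I_def case_prod_beta' by (intro finite_sum_le_infsum) auto
  \<comment> \<open>The increasing partial sums are bounded by the infinite sum, hence converge;
    \<open>s - BS N\<close> is the tail that measures truncation.\<close>
  obtain s where s: "BS \<longlonglongrightarrow> s" "\<And>N. BS N \<le> s"
    using incseq_convergent[OF BS_inc, of "\<Sum>\<^sub>\<infinity>(k, l)\<in>I \<times> I. (lam k l)\<^sup>2"] BS_le by blast
  have tau_m: "tau k \<in> borel_measurable Q" and theta_m: "theta k \<in> borel_measurable Q" if "k \<in> I" for k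
    using distributed_measurable[OF tau_normal[of k]] distributed_measurable[OF theta_normal[of k]] that
    unfolding I_def by auto
  have GK_m: "GK N \<in> borel_measurable Q" for N
    unfolding GK_def using K(2)[of N] tau_m theta_m
    by (intro borel_measurable_sum borel_measurable_times borel_measurable_const) auto
  have SK_m: "SK N n m \<in> borel_measurable P" for N n m
    unfolding SK_def using K(2)[of N]
    by (intro borel_measurable_sum borel_measurable_times borel_measurable_const S.X.nsum_meas S.Y.nsum_meas) auto
  have SLf_m: "SLf p \<in> borel_measurable P" for p
    unfolding SLf_def case_prod_beta' by (rule S.SL_meas[OF f_meas]) auto
  have trunc: "(\<integral>\<^sup>+w. ennreal ((SLf (n, m) w - SK N n m w)\<^sup>2) \<partial>P) \<le> ennreal (2 * (s - BS N))"
    if "n \<ge> 1" "m \<ge> 1" for N n m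
    unfolding SLf_def SK_def BS_def prod.case
    by (rule S.truncation_error[OF K _ f_meas _ that])
      (use s(2) f_expansion in \<open>simp_all add: BS_def K_def I_def\<close>)
  have bil: "((\<lambda>(n, m). \<integral>w. iexp (t * SK N n m w) \<partial>P) \<longlongrightarrow> (\<integral>q. iexp (t * GK N q) \<partial>Q)) (sequentially \<times>\<^sub>F sequentially)"
    for N t
  proof -
    \<comment> \<open>The argument \<open>t\<close> is absorbed into the coefficients; by
      orthonormality \<open>C\<close> is exactly the second moment of the random coefficient vector,
      for every \<open>m \<ge> 1\<close>.\<close>
    define C where "C = (\<Sum>k\<in>K N. \<Sum>l\<in>K N. (t * lam k l)\<^sup>2)"
    have tS: "t * SK N n m w = (\<Sum>k\<in>K N. \<Sum>l\<in>K N. (t * lam k l) * S.X.nsum n k w * S.Y.nsum m l w)" for n m w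
      by (simp add: SK_def sum_distrib_left mult.assoc)
    have tG: "t * GK N q = (\<Sum>k\<in>K N. \<Sum>l\<in>K N. (t * lam k l) * tau k q * theta l q)" for q
      by (simp add: GK_def sum_distrib_left mult.assoc)
    have os: "integrable P (\<lambda>w. (\<Sum>l\<in>K N. (t * lam k l) * S.Y.nsum m l w)\<^sup>2)"
        "(\<integral>w. (\<Sum>l\<in>K N. (t * lam k l) * S.Y.nsum m l w)\<^sup>2 \<partial>P) = (\<Sum>l\<in>K N. (t * lam k l)\<^sup>2)"
      if "m \<ge> 1" for k m
      using K(2)[of N] that by (auto intro!: orthonormal_sum K S.Y.nsum_prod)
    have mom: "(\<integral>w. (\<Sum>k\<in>K N. (\<Sum>l\<in>K N. (t * lam k l) * S.Y.nsum m l w)\<^sup>2) \<partial>P) \<le> C" if "m \<ge> 1" for m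
      unfolding C_def using os[OF that] by (subst Bochner_Integration.integral_sum) auto
    have indK: "Q.indep_var (Pi\<^sub>M (K N) (\<lambda>_. borel)) (\<lambda>w. restrict (\<lambda>k. tau k w) (K N))
      (Pi\<^sub>M (K N) (\<lambda>_. borel)) (\<lambda>w. restrict (\<lambda>k. theta k w) (K N))"
    proof -
      have "Q.indep_var (Pi\<^sub>M (K N) (\<lambda>_. borel)) ((\<lambda>x. restrict x (K N)) \<circ> (\<lambda>w. restrict (\<lambda>k. tau k w) I))
        (Pi\<^sub>M (K N) (\<lambda>_. borel)) ((\<lambda>x. restrict x (K N)) \<circ> (\<lambda>w. restrict (\<lambda>k. theta k w) I))"
        using K(2)[of N]
        by (intro Q.indep_var_compose[OF tau_theta_indep[folded I_def]] measurable_restrict_subset)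
      moreover have "I \<inter> K N = K N" using K(2)[of N] by auto
      ultimately show ?thesis by (simp add: comp_def)
    qed
    show ?thesis
      unfolding tS tG
    proof (rule bilinear_limit[OF P Q K(1)])
      show "S.X.nsum n k \<in> borel_measurable P" "S.Y.nsum n k \<in> borel_measurable P" if "k \<in> K N" for n k
        using K(2)[of N] that by (auto intro!: S.X.nsum_meas S.Y.nsum_meas)
      show "asymp_gaussian P (K N) S.X.nsum" "asymp_gaussian P (K N) S.Y.nsum"
        by (rule S.X.nsum_asymp_gaussian[OF K(1,2)], rule S.Y.nsum_asymp_gaussian[OF K(1,2)])
      show "tau k \<in> borel_measurable Q" "theta k \<in> borel_measurable Q" if "k \<in> K N" for k
        using K(2)[of N] tau_m theta_m that by auto
      show "(\<integral>w. iexp (\<Sum>k\<in>K N. b k * tau k w) \<partial>Q) = complex_of_real (exp (- (\<Sum>k\<in>K N. (b k)\<^sup>2) / 2))" for b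
        by (rule Q.std_normal_char[OF K(2)[unfolded I_def] tau_normal tau_indep])
      show "(\<integral>w. iexp (\<Sum>k\<in>K N. b k * theta k w) \<partial>Q) = complex_of_real (exp (- (\<Sum>k\<in>K N. (b k)\<^sup>2) / 2))" for b
        by (rule Q.std_normal_char[OF K(2)[unfolded I_def] theta_normal theta_indep])
    qed (use os mom indK S.nsum_vec_indep[OF K(2)] in auto)
  qed
  have char_lim: "((\<lambda>p. \<integral>w. iexp (t * SLf p w) \<partial>P) \<longlongrightarrow> (\<integral>q. iexp (t * Sinf q) \<partial>Q)) (sequentially \<times>\<^sub>F sequentially)"
    for t
  proof (rule tendstoI)
    fix e :: real assume e: "e > 0"
    \<comment> \<open>An L2 error of \<open>c\<close> costs \<open>\<bar>t\<bar> * sqrt c\<close>,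
      which this choice keeps below \<open>e / 3\<close>; the added 1 covers
      \<open>t = 0\<close>.\<close>
    define c where "c = (e / (3 * (\<bar>t\<bar> + 1)))\<^sup>2"
    have c: "c > 0" using e by (simp add: c_def)
    have "\<bar>t\<bar> * sqrt c = e / 3 * (\<bar>t\<bar> / (\<bar>t\<bar> + 1))" using e by (simp add: c_def real_sqrt_abs)
    also have "\<dots> < e / 3 * 1" using e by (intro mult_strict_left_mono) auto
    finally have tc: "\<bar>t\<bar> * sqrt c < e / 3" by simp
    \<comment> \<open>The half compensates the factor 2 in \<open>trunc\<close>. The level
      \<open>N\<close> is fixed here, before \<open>n\<close> and \<open>m\<close>, which the
      uniformity of \<open>trunc\<close> permits.\<close>
    have "\<forall>\<^sub>F N in sequentially. s - BS N < c / 2"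
      using order_tendstoD(2)[OF tendsto_diff[OF tendsto_const[of s] s(1)], of "c / 2"] c by simp
    moreover have "\<forall>\<^sub>F N in sequentially. (\<integral>\<^sup>+ w. ennreal ((Sinf w - GK N w)\<^sup>2) \<partial>Q) < ennreal c"
      using order_tendstoD(2)[OF Sinf_def, of "ennreal c"] c by (simp add: GK_def K_def I_def)
    ultimately obtain N where N: "s - BS N < c / 2" "(\<integral>\<^sup>+ w. ennreal ((Sinf w - GK N w)\<^sup>2) \<partial>Q) < ennreal c"
      using eventually_happens'[OF sequentially_bot eventually_conj] by blast
    have d2: "norm ((\<integral>q. iexp (t * Sinf q) \<partial>Q) - (\<integral>q. iexp (t * GK N q) \<partial>Q)) \<le> \<bar>t\<bar> * sqrt c"
      using N(2) c by (intro Q.norm_expectation_iexp_diff_le Sinf_meas GK_m) auto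
    have d1: "norm ((\<integral>w. iexp (t * SLf (n, m) w) \<partial>P) - (\<integral>w. iexp (t * SK N n m w) \<partial>P)) \<le> \<bar>t\<bar> * sqrt c"
      if nm: "n \<ge> 1" "m \<ge> 1" for n m
      using N(1) c order_trans[OF trunc[OF nm, of N] ennreal_leI[of _ c]]
      by (intro P.norm_expectation_iexp_diff_le SLf_m SK_m) auto
    have "\<forall>\<^sub>F p in sequentially \<times>\<^sub>F sequentially. fst p \<ge> 1 \<and> snd p \<ge> (1::nat)"
      unfolding eventually_prod_sequentially by (auto intro!: exI[of _ 1])
    moreover have "\<forall>\<^sub>F p in sequentially \<times>\<^sub>F sequentially.
        dist (case p of (n, m) \<Rightarrow> \<integral>w. iexp (t * SK N n m w) \<partial>P) (\<integral>q. iexp (t * GK N q) \<partial>Q) < e / 3"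
      using e by (intro tendstoD[OF bil]) simp
    ultimately show "\<forall>\<^sub>F p in sequentially \<times>\<^sub>F sequentially.
        dist (\<integral>w. iexp (t * SLf p w) \<partial>P) (\<integral>q. iexp (t * Sinf q) \<partial>Q) < e"
    proof eventually_elim
      case (elim p)
      obtain n m where p: "p = (n, m)" by (cases p)
      have "n \<ge> 1" "m \<ge> 1" using elim(1) p by auto
      have "dist (\<integral>w. iexp (t * SLf p w) \<partial>P) (\<integral>w. iexp (t * SK N n m w) \<partial>P) < e / 3"
        using d1[OF \<open>n \<ge> 1\<close> \<open>m \<ge> 1\<close>] tc unfolding p dist_norm by linarith
      moreover have "dist (\<integral>w. iexp (t * SK N n m w) \<partial>P) (\<integral>q. iexp (t * GK N q) \<partial>Q) < e / 3"
        using elim(2) unfolding p prod.case .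
      moreover have "dist (\<integral>q. iexp (t * GK N q) \<partial>Q) (\<integral>q. iexp (t * Sinf q) \<partial>Q) < e / 3"
        using d2 tc unfolding dist_norm by (subst norm_minus_commute) linarith
      ultimately show ?case by (rule dist_triangle_third)
    qed
  qed
  show ?thesis
  proof (intro allI impI)
    fix \<phi> :: "real \<Rightarrow> real" assume \<phi>: "continuous_on UNIV \<phi> \<and> bounded (range \<phi>)"
    then have cont: "isCont \<phi> x" for x by (simp add: continuous_on_eq_continuous_at)
    have \<phi>m: "\<phi> \<in> borel_measurable borel"
      using \<phi> by (intro borel_measurable_continuous_onI) simp
    obtain D where D: "\<And>x. norm (\<phi> x) \<le> D"
      using \<phi> by (auto simp: bounded_iff)
    have "((\<lambda>p. \<integral>w. \<phi> (SLf p w) \<partial>P) \<longlongrightarrow> (\<integral>w. \<phi> (Sinf w) \<partial>Q)) (sequentially \<times>\<^sub>F sequentially)"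
    proof (rule tendsto_prod_sequentiallyI)
      fix p :: "nat \<Rightarrow> nat \<times> nat" assume p: "filterlim p (sequentially \<times>\<^sub>F sequentially) sequentially"
      have rd: "real_distribution (distr P borel (SLf (p j)))" "real_distribution (distr Q borel Sinf)" for j
        using SLf_m Sinf_meas by (auto intro!: P.real_distribution_distr Q.real_distribution_distr)
      \<comment> \<open>Along \<open>p\<close> the characteristic functions converge pointwise to
        that of an actual law, so Levy's theorem yields weak convergence.\<close>
      have "weak_conv_m (\<lambda>j. distr P borel (SLf (p j))) (distr Q borel Sinf)"
      proof (rule levy_continuity[OF rd])
        fix t
        show "(\<lambda>j. char (distr P borel (SLf (p j))) t) \<longlonglongrightarrow> char (distr Q borel Sinf) t"
          using filterlim_compose[OF char_lim p, of t] SLf_m Sinf_meas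
          by (simp add: char_def integral_distr)
      qed
      from weak_conv_imp_integral_bdd_continuous_conv[OF rd this cont D]
      show "(\<lambda>j. \<integral>w. \<phi> (SLf (p j) w) \<partial>P) \<longlonglongrightarrow> (\<integral>w. \<phi> (Sinf w) \<partial>Q)"
        using SLf_m Sinf_meas \<phi>m by (simp add: integral_distr)
    qed
    then show "((\<lambda>(n1, n2). \<integral>w. \<phi> (SL f xi eta ({1..n1} \<times> {1..n2}) w) \<partial>P)
        \<longlongrightarrow> (\<integral>w. \<phi> (Sinf w) \<partial>Q)) (at_top \<times>\<^sub>F at_top)"
      unfolding SLf_def case_prod_beta' .
  qed
qed

end
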